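(* Let $h\in\mathcal Z_+'$ be real, let $b\in C_0^\infty(\mathbb R)'$ be its $b$-function and $s\in\mathcal Z'$ its sign-function. For each choice of the sign $\pm$ (the same in all three conditions), the following conditions are equivalent: (i) $\pm\langle h,\bar f\star f\rangle\ge0$ for all $f\in\mathcal D$; (ii) $\pm\langle b,(\mathcal J\bar g)*g\rangle\ge0$ for all $g\in C_0^\infty(\mathbb R)$; (iii) $\pm\langle s,|u|^2\rangle\ge0$ for all $u\in\mathcal Z$.
   Context: Notation: $\mathbb R_+=(0,\infty)$; $\Gamma$ is the gamma function; $(\Phi u)(\xi)=(2\pi)^{-1/2}\int_{-\infty}^\infty u(x)e^{-ix\xi}dx$ is the Fourier transform. For a topological vector space $\mathcal L$, $\mathcal L'$ is the space of continuous antilinear functionals; brackets $\langle\cdot,\cdot\rangle$ are linear in the first and antilinear in the second argument. $\mathcal Z$ is the set of Schwartz functions $\varphi$ on $\mathbb R$ that extend to entire functions with $|\varphi(z)|\le C_n(1+|z|)^{-n}e^{r|\operatorname{Im}z|}$ for all $n$ and some $r=r(\varphi)>0$; thus $\Phi:C_0^\infty(\mathbb R)\to\mathcal Z$ and $\Phi^*:\mathcal Z\to C_0^\infty(\mathbb R)$ are bijections, and $\mathcal Z$ carries the corresponding topology. For $u\in\mathcal Z$, $|u|^2$ (as a function on $\mathbb R$) belongs to $\mathcal Z$. $\mathcal Z_+$ is the set of functions $F$ on $\mathbb R_+$ such that $\Omega(x)=F(e^x)$ belongs to $\mathcal Z$ (with the transferred topology), and $\mathcal Z_+'$ is its dual.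 For $h\in\mathcal Z_+'$ the distribution $\theta(x)=e^xh(e^x)\in\mathcal Z'$ is defined by $\langle\theta,\Omega\rangle=\langle h,F\rangle$ for $\Omega(x)=F(e^x)$. The distribution $h$ is real if $\langle h,\bar F\rangle=\overline{\langle h,F\rangle}$ for all $F\in\mathcal Z_+$. The $b$- and sign-functions of $h\in\mathcal Z_+'$: put $a=\Phi\theta\in C_0^\infty(\mathbb R)'$, i.e. $\langle a,g\rangle=\langle\theta,\Phi^*g\rangle$; the $b$-function is $b(\xi)=(2\pi)^{-1/2}a(\xi)\Gamma(1-i\xi)^{-1}\in C_0^\infty(\mathbb R)'$, i.e. $\langle b,G\rangle=(2\pi)^{-1/2}\langle a,\Gamma(1+i\,\cdot)^{-1}G\rangle$; the sign-function is $s=\sqrt{2\pi}\,\Phi^*b\in\mathcal Z'$, i.e. $\langle s,\varphi\rangle=\sqrt{2\pi}\langle b,\Phi\varphi\rangle$. $\mathcal D$ is the set of functions $f$ on $\mathbb R_+$ such that $e^{x/2}f(e^x)$ belongs to $\mathcal Z$ as a function of $x\in\mathbb R$. The Laplace convolution is $(\bar f_1\star f_2)(t)=\int_0^t\overline{f_1(s)}f_2(t-s)ds$; for $f_1,f_2\in\mathcal D$ it belongs to $\mathcal Z_+$. Further $(g_1*g_2)(\xi)=\int_{-\infty}^\infty g_1(\xi-\eta)g_2(\eta)d\eta$ and $(\mathcal Jg)(\xi)=g(-\xi)$. *)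

theory Defs
  imports "HOL-Analysis.Analysis"
begin

section \<open>Smooth functions of a real variable\<close>

definition nderiv :: "nat \<Rightarrow> (real \<Rightarrow> complex) \<Rightarrow> real \<Rightarrow> complex" where
  "nderiv n = (\<lambda>f x. vector_derivative f (at x)) ^^ n"

definition smooth_fun :: "(real \<Rightarrow> complex) \<Rightarrow> bool" where
  "smooth_fun f \<longleftrightarrow> (\<forall>n x. nderiv n f differentiable (at x))"

definition schwartz_fun :: "(real \<Rightarrow> complex) \<Rightarrow> bool" where
  "schwartz_fun f \<longleftrightarrow> smooth_fun f \<and> (\<forall>m n. \<exists>C. \<forall>x. \<bar>x\<bar> ^ m * norm (nderiv n f x) \<le> C)"

section \<open>Test functions and their inductive limit topology\<close>

definition test_funs_on :: "real set \<Rightarrow> (real \<Rightarrow> complex) set" where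
  "test_funs_on K = {f. smooth_fun f \<and> (\<forall>x. x \<notin> K \<longrightarrow> f x = 0)}"

definition test_funs :: "(real \<Rightarrow> complex) set" where
  "test_funs = (\<Union>K\<in>{K. compact K}. test_funs_on K)"

text \<open>
  The topology of uniform convergence of all derivatives on functions supported in a fixed
  compact \<open>K\<close>. The suprema of the derivatives over the real line are attained, so
  the pointwise strict inequality describes an open ball of the corresponding seminorm.
\<close>

definition test_topology_on :: "real set \<Rightarrow> (real \<Rightarrow> complex) topology" where
  "test_topology_on K = topology_generated_by
     {{g \<in> test_funs_on K. \<forall>x. norm (nderiv n g x - nderiv n f x) < \<epsilon>} | f n \<epsilon>.
        f \<in> test_funs_on K \<and> (\<epsilon>::real) > 0}"

definition abs_convex :: "(real \<Rightarrow> complex) set \<Rightarrow> bool" where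
  "abs_convex W \<longleftrightarrow>
     (\<forall>v\<in>W. \<forall>w\<in>W. \<forall>t\<in>{0..1::real}.
        (\<lambda>x. of_real (1 - t) * v x + of_real t * w x) \<in> W) \<and>
     (\<forall>w\<in>W. \<forall>c::complex. norm c \<le> 1 \<longrightarrow> (\<lambda>x. c * w x) \<in> W)"

text \<open>
  The strict inductive limit (LF) topology on all test functions, as in Rudin's
  \<open>Functional Analysis\<close>: it is generated by the translates of those convex balanced
  sets whose trace on the functions supported in \<open>K\<close> is open for every compact \<open>K\<close>.
\<close>

definition test_topology :: "(real \<Rightarrow> complex) topology" where
  "test_topology = topology_generated_by
     {(\<lambda>w x. f x + w x) ` W | f W.
        f \<in> test_funs \<and> W \<subseteq> test_funs \<and> abs_convex W \<and>
        (\<forall>K. compact K \<longrightarrow> openin (test_topology_on K) (W \<inter> test_funs_on K))}"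

text \<open>
  Continuous antilinear functionals on a function space \<open>X\<close> with topology \<open>T\<close>.
  The pairing of a functional \<open>L\<close> with \<open>f\<close> is the application \<open>L f\<close>; the values
  of \<open>L\<close> outside \<open>X\<close> carry no information.
\<close>

definition antidual ::
  "(real \<Rightarrow> complex) set \<Rightarrow> (real \<Rightarrow> complex) topology \<Rightarrow> ((real \<Rightarrow> complex) \<Rightarrow> complex) set" where
  "antidual X T = {L.
     (\<forall>f\<in>X. \<forall>g\<in>X. L (\<lambda>x. f x + g x) = L f + L g) \<and>
     (\<forall>c. \<forall>f\<in>X. L (\<lambda>x. c * f x) = cnj c * L f) \<and>
     continuous_map T euclidean L}"

section \<open>The Fourier transform and the spaces of entire test functions\<close>

definition fourier :: "(real \<Rightarrow> complex) \<Rightarrow> real \<Rightarrow> complex" where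
  "fourier u \<xi> = of_real (1 / sqrt (2 * pi)) *
     (LBINT x. u x * exp (- (\<i> * of_real x * of_real \<xi>)))"

definition fourier_adj :: "(real \<Rightarrow> complex) \<Rightarrow> real \<Rightarrow> complex" where
  "fourier_adj g x = of_real (1 / sqrt (2 * pi)) *
     (LBINT \<xi>. g \<xi> * exp (\<i> * of_real x * of_real \<xi>))"

definition Z_space :: "(real \<Rightarrow> complex) set" where
  "Z_space = {\<phi>. schwartz_fun \<phi> \<and>
     (\<exists>\<psi>::complex \<Rightarrow> complex. \<psi> holomorphic_on UNIV \<and> (\<forall>x. \<psi> (of_real x) = \<phi> x) \<and>
        (\<exists>r::real. r > 0 \<and> (\<forall>n::nat. \<exists>C::real. \<forall>z.
           norm (\<psi> z) \<le> C * inverse ((1 + norm z) ^ n) * exp (r * \<bar>Im z\<bar>))))}"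

definition Z_topology :: "(real \<Rightarrow> complex) topology" where
  "Z_topology = pullback_topology Z_space fourier test_topology"

text \<open>
  A function on \<open>(0,\<infinity>)\<close> is represented by its extension by zero to the real line.
\<close>

definition Zplus_space :: "(real \<Rightarrow> complex) set" where
  "Zplus_space = {F. (\<forall>t\<le>0. F t = 0) \<and> (\<lambda>x. F (exp x)) \<in> Z_space}"

definition Zplus_topology :: "(real \<Rightarrow> complex) topology" where
  "Zplus_topology = pullback_topology Zplus_space (\<lambda>F x. F (exp x)) Z_topology"

definition D_space :: "(real \<Rightarrow> complex) set" where
  "D_space = {f. (\<forall>t\<le>0. f t = 0) \<and> (\<lambda>x. of_real (exp (x / 2)) * f (exp x)) \<in> Z_space}"

definition real_functional :: "((real \<Rightarrow> complex) \<Rightarrow> complex) \<Rightarrow> bool" where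
  "real_functional h \<longleftrightarrow> (\<forall>F\<in>Zplus_space. h (\<lambda>t. cnj (F t)) = cnj (h F))"

section \<open>The b-function and the sign-function\<close>

text \<open>
  \<open>theta_fun h\<close> is the distribution \<open>e\<^sup>x h(e\<^sup>x)\<close>, acting on \<open>\<Omega>\<close> as \<open>h\<close> acts on
  the unique \<open>F\<close> on \<open>(0,\<infinity>)\<close> with \<open>\<Omega>(x) = F(e\<^sup>x)\<close>.
\<close>

definition theta_fun :: "((real \<Rightarrow> complex) \<Rightarrow> complex) \<Rightarrow> (real \<Rightarrow> complex) \<Rightarrow> complex" where
  "theta_fun h \<Omega> = h (\<lambda>t. if t > 0 then \<Omega> (ln t) else 0)"

definition a_fun :: "((real \<Rightarrow> complex) \<Rightarrow> complex) \<Rightarrow> (real \<Rightarrow> complex) \<Rightarrow> complex" where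
  "a_fun h g = theta_fun h (fourier_adj g)"

definition b_fun :: "((real \<Rightarrow> complex) \<Rightarrow> complex) \<Rightarrow> (real \<Rightarrow> complex) \<Rightarrow> complex" where
  "b_fun h G = of_real (1 / sqrt (2 * pi)) *
     a_fun h (\<lambda>\<xi>. inverse (Gamma (1 + \<i> * of_real \<xi>)) * G \<xi>)"

definition sign_fun :: "((real \<Rightarrow> complex) \<Rightarrow> complex) \<Rightarrow> (real \<Rightarrow> complex) \<Rightarrow> complex" where
  "sign_fun h \<phi> = of_real (sqrt (2 * pi)) * b_fun h (fourier \<phi>)"

section \<open>Convolutions\<close>

definition laplace_conv :: "(real \<Rightarrow> complex) \<Rightarrow> (real \<Rightarrow> complex) \<Rightarrow> real \<Rightarrow> complex" where
  "laplace_conv f\<^sub>1 f\<^sub>2 t = (LBINT s:{0..t}. f\<^sub>1 s * f\<^sub>2 (t - s))"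

definition convol :: "(real \<Rightarrow> complex) \<Rightarrow> (real \<Rightarrow> complex) \<Rightarrow> real \<Rightarrow> complex" where
  "convol g\<^sub>1 g\<^sub>2 \<xi> = (LBINT \<eta>. g\<^sub>1 (\<xi> - \<eta>) * g\<^sub>2 \<eta>)"

definition reflect :: "(real \<Rightarrow> complex) \<Rightarrow> real \<Rightarrow> complex" where
  "reflect g \<xi> = g (- \<xi>)"

end

(* The Fourier transform maps Z onto the test functions, so an element f of D has the form
   f(t) = (2 pi)^(-1/2) int g(xi) t^(-1/2 + i xi) dxi with a test function g. By the Beta integral,
   the Laplace convolution of t^(-1/2 - i eta) and t^(-1/2 + i xi) is
   Gamma(1/2 - i eta) Gamma(1/2 + i xi) / Gamma(1 + i(xi - eta)) * t^(i(xi - eta)).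
   Hence the convolution of conj f and f at t = e^x is, up to a constant factor, the inverse Fourier
   transform of ((J conj G) * G)(zeta) / Gamma(1 + i zeta) at x, where G(xi) = Gamma(1/2 + i xi) g(xi).
   Since Gamma has no zeros and no poles on the line Re z = 1/2, f -> G is a bijection of D onto
   the test functions, and (i) is (ii). Condition (iii) is (ii) because the Fourier transform
   of |u|^2 is (2 pi)^(-1/2) (J conj g) * g with g the Fourier transform of u. *)
theory Submission
  imports Defs
    "HOL-Probability.Characteristic_Functions"
    "HOL-Probability.Sinc_Integral"
    "HOL-Complex_Analysis.Cauchy_Integral_Formula"
begin

section \<open>Smooth functions\<close>

text \<open>The weight e^(x/2) in \<open>D_space\<close> is the origin of the exponent -1/2, and
  this exponent legitimises the first exchanges of integrals: the modulus of t^(-1/2 + i xi) does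
  not depend on xi, and t^(-1/2) is integrable at 0, so s^(-1/2) (t - s)^(-1/2) dominates uniformly
  in both frequencies. The obstacle lies in the last exchange, because 1/Gamma(1 + i zeta) grows
  exponentially; the compact support of G saves it by confining zeta to a bounded interval. The Beta
  constant comes from an argument of Laplace type: by scaling, a convolution of two powers is a
  multiple of a power, and integration against e^(-t) turns the convolution into a product of Gamma
  values. \<open>b_fun h\<close> and \<open>sign_fun h\<close> are values of \<open>h\<close> at
  explicit functions, so the equivalences rest on equalities of functions. All three conditions are
  quadratic in f, g or u; a factor (2 pi)^(1/2) is therefore absorbed as (2 pi)^(1/4) in the
  function, whence the nested square roots.\<close>

lemma nderiv_0 [simp]: "nderiv 0 f = f"
  by (simp add: nderiv_def)

lemma nderiv_Suc: "nderiv (Suc n) f = (\<lambda>x. vector_derivative (nderiv n f) (at x))"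
  by (simp add: nderiv_def)

lemma nderiv_Suc': "nderiv (Suc n) f = nderiv n (\<lambda>x. vector_derivative f (at x))"
  unfolding nderiv_def by (subst funpow_Suc_right) simp

lemma smooth_fun_has_nderiv:
  assumes "smooth_fun f"
  shows "(nderiv n f has_vector_derivative nderiv (Suc n) f x) (at x)"
  using assms unfolding smooth_fun_def nderiv_Suc by (simp add: vector_derivative_works)

lemma smooth_fun_nderiv:
  assumes "smooth_fun f"
  shows "smooth_fun (nderiv n f)"
proof -
  have "nderiv m (nderiv n f) = nderiv (m + n) f" for m
    by (simp add: nderiv_def funpow_add)
  thus ?thesis using assms by (simp add: smooth_fun_def)
qed

text \<open>A tower of candidates, each the derivative of the one before, identifies all iterated
  derivatives at once. With \<open>smooth_funI\<close> this reduces smoothness of holomorphic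
  restrictions and of Fourier integrals to a single differentiation.\<close>

lemma nderiv_eqI:
  assumes "\<And>n x. (F n has_vector_derivative F (Suc n) x) (at x)"
  shows "nderiv n (F 0) = F n"
proof (induction n)
  case (Suc n)
  show ?case by (simp add: nderiv_Suc Suc vector_derivative_at[OF assms])
qed simp

lemma smooth_funI:
  assumes "\<And>n x. (F n has_vector_derivative F (Suc n) x) (at x)"
  shows "smooth_fun (F 0)"
  unfolding smooth_fun_def using nderiv_eqI[of F, OF assms] assms
  by (metis differentiableI_vector)

lemma smooth_fun_continuous_on:
  assumes "smooth_fun f"
  shows "continuous_on S f"
  using assms unfolding smooth_fun_def
  by (intro continuous_at_imp_continuous_on ballI differentiable_imp_continuous_within)
     (metis nderiv_0)

text \<open>Finite order is what makes induction possible for products: the derivative of a product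
  is a sum of products whose factors are smooth to one order less, so no higher Leibniz formula has
  to be stated.\<close>

definition smooth_upto :: "nat \<Rightarrow> (real \<Rightarrow> complex) \<Rightarrow> bool" where
  "smooth_upto n f \<longleftrightarrow> (\<forall>k\<le>n. \<forall>x. nderiv k f differentiable (at x))"

lemma smooth_fun_iff_upto: "smooth_fun f \<longleftrightarrow> (\<forall>n. smooth_upto n f)"
  by (auto simp: smooth_fun_def smooth_upto_def)

lemma smooth_upto_0: "smooth_upto 0 f \<longleftrightarrow> (\<forall>x. f differentiable (at x))"
  by (simp add: smooth_upto_def)

lemma smooth_upto_Suc:
  "smooth_upto (Suc n) f \<longleftrightarrow>
     (\<forall>x. f differentiable (at x)) \<and> smooth_upto n (\<lambda>x. vector_derivative f (at x))"
proof -
  have "(\<forall>k\<le>Suc n. P k) \<longleftrightarrow> P 0 \<and> (\<forall>k\<le>n. P (Suc k))" for P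
    by (metis Suc_le_mono zero_le not0_implies_Suc)
  thus ?thesis by (simp add: smooth_upto_def nderiv_Suc')
qed

lemma smooth_upto_mono: "smooth_upto n f \<Longrightarrow> m \<le> n \<Longrightarrow> smooth_upto m f"
  by (auto simp: smooth_upto_def)

lemma smooth_upto_add:
  "smooth_upto n f \<Longrightarrow> smooth_upto n g \<Longrightarrow> smooth_upto n (\<lambda>x. f x + g x)"
proof (induction n arbitrary: f g)
  case (Suc n)
  hence "(\<lambda>x. vector_derivative (\<lambda>x. f x + g x) (at x)) =
         (\<lambda>x. vector_derivative f (at x) + vector_derivative g (at x))"
    by (intro ext vector_derivative_at has_vector_derivative_add)
       (auto simp: smooth_upto_Suc simp flip: vector_derivative_works)
  with Suc show ?case by (auto simp: smooth_upto_Suc)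
qed (auto simp: smooth_upto_0)

lemma smooth_upto_mult:
  "smooth_upto n f \<Longrightarrow> smooth_upto n g \<Longrightarrow> smooth_upto n (\<lambda>x. f x * g x)"
proof (induction n arbitrary: f g)
  case (Suc n)
  hence "(\<lambda>x. vector_derivative (\<lambda>x. f x * g x) (at x)) =
         (\<lambda>x. f x * vector_derivative g (at x) + vector_derivative f (at x) * g x)"
    by (intro ext vector_derivative_at has_vector_derivative_mult)
       (auto simp: smooth_upto_Suc simp flip: vector_derivative_works)
  moreover have "smooth_upto n f" "smooth_upto n g"
    using Suc.prems by (auto intro: smooth_upto_mono)
  ultimately show ?case using Suc
    by (auto simp: smooth_upto_Suc intro!: smooth_upto_add)
qed (auto simp: smooth_upto_0)

lemma smooth_fun_mult:
  "smooth_fun f \<Longrightarrow> smooth_fun g \<Longrightarrow> smooth_fun (\<lambda>x. f x * g x)"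
  by (simp add: smooth_fun_iff_upto smooth_upto_mult)

text \<open>By the chain rule each real derivative along the line brings a factor
  \<open>\<i>\<close>, which gives the tower \<open>D\<close>. Apart from the Gamma factors, this
  also supplies constants and powers as smooth functions.\<close>

lemma smooth_fun_holomorphic_vertical_line:
  assumes F: "F holomorphic_on S" "open S" and S: "\<And>x::real. a + \<i> * of_real x \<in> S"
  shows "smooth_fun (\<lambda>x. F (a + \<i> * of_real x))"
proof -
  define D where "D = (\<lambda>n x. \<i> ^ n * (deriv ^^ n) F (a + \<i> * of_real x))"
  have "smooth_fun (D 0)"
  proof (rule smooth_funI)
    fix n and x :: real
    have "((deriv ^^ n) F has_field_derivative (deriv ^^ Suc n) F (a + \<i> * of_real x))
            (at (a + \<i> * of_real x))"
      using holomorphic_derivI[OF holomorphic_higher_deriv[OF F] \<open>open S\<close> S] by simp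
    moreover have "((\<lambda>x. a + \<i> * of_real x) has_vector_derivative \<i>) (at x)"
      by (auto intro!: derivative_eq_intros has_vector_derivative_real_field)
    ultimately have "((\<lambda>x. (deriv ^^ n) F (a + \<i> * of_real x)) has_vector_derivative
                       \<i> * (deriv ^^ Suc n) F (a + \<i> * of_real x)) (at x)"
      using field_vector_diff_chain_at[of "\<lambda>x. a + \<i> * of_real x"] by (simp add: o_def)
    from has_vector_derivative_mult_right[OF this, of "\<i> ^ n"]
    show "(D n has_vector_derivative D (Suc n) x) (at x)"
      by (simp add: D_def mult_ac)
  qed
  thus ?thesis by (simp add: D_def)
qed

section \<open>Test functions\<close>

lemma test_funs_iff:
  "g \<in> test_funs \<longleftrightarrow> smooth_fun g \<and> (\<exists>r>0. \<forall>x. r < \<bar>x\<bar> \<longrightarrow> g x = 0)"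
proof safe
  assume "g \<in> test_funs"
  then obtain K where K: "compact K" "smooth_fun g" "\<And>x. x \<notin> K \<Longrightarrow> g x = 0"
    by (auto simp: test_funs_def test_funs_on_def)
  thus "smooth_fun g" by simp
  obtain r where "r > 0" "\<And>x. x \<in> K \<Longrightarrow> norm x \<le> r"
    using compact_imp_bounded[OF K(1)] by (auto simp: bounded_pos)
  with K(3) show "\<exists>r>0. \<forall>x. r < \<bar>x\<bar> \<longrightarrow> g x = 0"
    by (metis linorder_not_less real_norm_def)
next
  fix r :: real
  assume "smooth_fun g" "r > 0" "\<forall>x. r < \<bar>x\<bar> \<longrightarrow> g x = 0"
  hence "g \<in> test_funs_on {-r..r}" by (auto simp: test_funs_on_def)
  thus "g \<in> test_funs" unfolding test_funs_def by blast
qed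

lemma smooth_fun_mult_test_funs:
  assumes "smooth_fun f" "g \<in> test_funs"
  shows "(\<lambda>x. f x * g x) \<in> test_funs"
  using assms unfolding test_funs_iff by (auto intro: smooth_fun_mult)

lemma smooth_fun_const: "smooth_fun (\<lambda>x. c)"
  using smooth_fun_holomorphic_vertical_line[of "\<lambda>_. c" UNIV 0] by simp

lemma smooth_fun_power: "smooth_fun (\<lambda>x. (\<i> * of_real x) ^ n)"
  using smooth_fun_holomorphic_vertical_line[of "\<lambda>z. z ^ n" UNIV 0]
  by (simp add: holomorphic_on_power)

lemma test_funs_vanishing_deriv:
  assumes "\<And>x. r < \<bar>x\<bar> \<Longrightarrow> g x = 0" "r < \<bar>x\<bar>"
  shows "vector_derivative g (at x) = 0"
proof (rule vector_derivative_at)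
  have "open {x::real. r < \<bar>x\<bar>}" by (intro open_Collect_less continuous_intros)
  have "((\<lambda>_. 0) has_vector_derivative 0) (at x)" by simp
  thus "(g has_vector_derivative 0) (at x)"
    by (rule has_vector_derivative_transform_within_open[OF _ \<open>open _\<close>]) (use assms in auto)
qed

lemma nderiv_test_funs:
  assumes "g \<in> test_funs"
  shows "nderiv n g \<in> test_funs"
proof -
  obtain r where g: "smooth_fun g" "r > 0" "\<And>x. r < \<bar>x\<bar> \<Longrightarrow> g x = 0"
    using assms by (auto simp: test_funs_iff)
  have "\<forall>x. r < \<bar>x\<bar> \<longrightarrow> nderiv n g x = 0"
  proof (induction n)
    case (Suc n)
    thus ?case using test_funs_vanishing_deriv[of r "nderiv n g"] by (simp add: nderiv_Suc)
  qed (use g in simp)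
  with g smooth_fun_nderiv show ?thesis by (auto simp: test_funs_iff)
qed

lemma test_funs_continuous_on: "g \<in> test_funs \<Longrightarrow> continuous_on S g"
  by (simp add: test_funs_iff smooth_fun_continuous_on)

lemma test_funs_bounded:
  assumes "g \<in> test_funs"
  obtains C where "\<And>x. norm (g x) \<le> C"
proof -
  obtain r where g: "r > 0" "\<And>x. r < \<bar>x\<bar> \<Longrightarrow> g x = 0"
    using assms by (auto simp: test_funs_iff)
  have "compact (g ` {-r..r})"
    by (intro compact_continuous_image test_funs_continuous_on assms) auto
  then obtain C where "C > 0" "\<And>x. x \<in> {-r..r} \<Longrightarrow> norm (g x) \<le> C"
    using compact_imp_bounded by (force simp: bounded_pos)
  with g have "norm (g x) \<le> C" for x by (cases "r < \<bar>x\<bar>") (auto simp: abs_le_iff not_less)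
  thus ?thesis using that by blast
qed

lemma test_funs_integrable:
  assumes "g \<in> test_funs"
  shows "integrable lborel g"
proof -
  obtain r where g: "r > 0" "\<And>x. r < \<bar>x\<bar> \<Longrightarrow> g x = 0"
    using assms by (auto simp: test_funs_iff)
  have "set_integrable lborel {-r..r} g"
    by (intro borel_integrable_atLeastAtMost' test_funs_continuous_on assms)
  moreover have "(\<lambda>x. indicator {-r..r} x *\<^sub>R g x) = g"
    using g by (auto simp: fun_eq_iff indicator_def)
  ultimately show ?thesis by (simp add: set_integrable_def)
qed

section \<open>Fourier integrals\<close>

abbreviation fkern :: "real \<Rightarrow> real \<Rightarrow> complex" where
  "fkern x y \<equiv> exp (\<i> * of_real x * of_real y)"

lemma fkern_conv_iexp: "fkern x y = iexp (x * y)"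
  by (simp add: mult.assoc)

lemma norm_fkern [simp]: "norm (fkern x y) = 1"
  unfolding fkern_conv_iexp by (rule norm_exp_i_times)

lemma borel_measurable_fkern [measurable]:
  assumes [measurable]: "f \<in> borel_measurable M" "g \<in> borel_measurable M"
  shows "(\<lambda>x. fkern (f x) (g x)) \<in> borel_measurable M"
proof -
  have "exp \<in> borel_measurable (borel :: complex measure)"
    by (intro borel_measurable_continuous_onI continuous_intros)
  thus ?thesis by measurable
qed

lemma integrable_fkern:
  assumes "integrable lborel u"
  shows "integrable lborel (\<lambda>x. u x * fkern t x)"
    and "integrable lborel (\<lambda>x. u x * fkern x t)"
proof -
  have [measurable]: "u \<in> borel_measurable borel"
    using borel_measurable_integrable[OF assms] by simp
  show "integrable lborel (\<lambda>x. u x * fkern t x)" "integrable lborel (\<lambda>x. u x * fkern x t)"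
    by (rule Bochner_Integration.integrable_bound[OF assms]; simp add: norm_mult)+
qed

lemma fourier_conv_adj: "fourier u \<xi> = fourier_adj u (- \<xi>)"
  unfolding fourier_def fourier_adj_def
  by (intro arg_cong2[of _ _ _ _ "(*)"] Bochner_Integration.integral_cong refl)
     (simp add: mult_ac)

text \<open>Reflecting the function instead of the frequency transfers results on
  \<open>fourier_adj\<close> to \<open>fourier\<close>; combined with
  \<open>fourier_conv_adj\<close> it also derives the second inversion formula from the
  first.\<close>

lemma fourier_conv_adj_reflect: "fourier u \<xi> = fourier_adj (\<lambda>x. u (- x)) \<xi>"
  unfolding fourier_def fourier_adj_def
  by (subst lborel_integral_real_affine[where c="-1" and t=0])
     (auto intro!: arg_cong2[of _ _ _ _ "(*)"] Bochner_Integration.integral_cong simp: mult_ac)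

text \<open>Lipschitz continuity in the frequency with constant \<open>\<bar>x\<bar>\<close> is the
  source of the integrable majorant when Fourier integrals are differentiated.\<close>

lemma fkern_diff_le: "norm (fkern s x - fkern t x) \<le> \<bar>s - t\<bar> * \<bar>x\<bar>"
proof -
  have "fkern s x - fkern t x = fkern t x * (iexp ((s - t) * x) - 1)"
    by (simp add: algebra_simps flip: exp_add)
  also have "norm \<dots> = norm (iexp ((s - t) * x) - 1)"
    by (simp add: norm_mult)
  also have "\<dots> \<le> \<bar>(s - t) * x\<bar>"
    using iexp_approx1[of "(s - t) * x" 0] by simp
  finally show ?thesis by (simp add: abs_mult)
qed

lemma fkern_has_vector_derivative:
  "((\<lambda>s. fkern s x) has_vector_derivative \<i> * of_real x * fkern t x) (at t)"
proof -
  have "((\<lambda>s. \<i> * of_real s * of_real x) has_vector_derivative \<i> * of_real x) (at t)"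
    by (auto intro!: derivative_eq_intros has_vector_derivative_real_field)
  from field_vector_diff_chain_at[OF this, of exp "fkern t x"]
  show ?thesis by (auto simp: o_def intro: DERIV_exp)
qed

text \<open>Differentiation under the integral sign by dominated convergence: the normalised
  first-order remainder of the kernel tends to 0 pointwise and is at most
  \<open>2 * \<bar>x\<bar>\<close>, so integrability of x u(x) provides the majorant.\<close>

lemma fourier_adj_has_vector_derivative:
  assumes u: "integrable lborel u" and xu: "integrable lborel (\<lambda>x. of_real x * u x)"
  shows "(fourier_adj u has_vector_derivative fourier_adj (\<lambda>x. \<i> * of_real x * u x) t) (at t)"
proof -
  define c where "c = complex_of_real (1 / sqrt (2 * pi))"
  \<comment> \<open>The remainder is divided by the norm of the increment exactly as in
    \<open>has_derivative_at2\<close>, so that \<open>quot\<close> turns the goal into one limit of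
    integrals.\<close>
  define e where "e = (\<lambda>s x. (1 / norm (s - t)) *\<^sub>R
     (fkern s x - (fkern t x + (s - t) *\<^sub>R (\<i> * of_real x * fkern t x))))"
  have [measurable]: "u \<in> borel_measurable borel"
    using borel_measurable_integrable[OF u] by simp
  have xu': "integrable lborel (\<lambda>x. \<i> * of_real x * u x)"
    using integrable_mult_right[OF xu, of \<i>] by (simp add: mult.assoc)
  have quot: "(1 / norm (s - t)) *\<^sub>R (fourier_adj u s -
      (fourier_adj u t + (s - t) *\<^sub>R fourier_adj (\<lambda>x. \<i> * of_real x * u x) t)) =
      c * (LBINT x. u x * e s x)" for s
  proof -
    have "(LBINT x. u x * e s x) = (LBINT x. (1 / norm (s - t)) *\<^sub>R (u x * fkern s x -
            (u x * fkern t x + (s - t) *\<^sub>R ((\<i> * of_real x * u x) * fkern t x))))"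
      by (intro Bochner_Integration.integral_cong refl)
         (simp add: e_def scaleR_conv_of_real algebra_simps)
    also have "\<dots> = (1 / norm (s - t)) *\<^sub>R ((LBINT x. u x * fkern s x) -
            ((LBINT x. u x * fkern t x) + (s - t) *\<^sub>R (LBINT x. (\<i> * of_real x * u x) * fkern t x)))"
      by (simp only: integral_scaleR_right Bochner_Integration.integral_diff
            Bochner_Integration.integral_add integrable_fkern[OF u] integrable_fkern[OF xu']
            Bochner_Integration.integrable_add integrable_scaleR_right)
    finally have *: "(LBINT x. u x * e s x) = \<dots>" .
    have alg: "k *\<^sub>R (c * A - (c * B + d *\<^sub>R (c * D))) = c * (k *\<^sub>R (A - (B + d *\<^sub>R D)))"
      for A B D :: complex and k d
      by (simp add: scaleR_conv_of_real algebra_simps)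
    show ?thesis
      unfolding fourier_adj_def c_def[symmetric] alg * ..
  qed
  have [measurable]: "e s \<in> borel_measurable borel" for s
    unfolding e_def by measurable
  have e_le: "norm (e s x) \<le> 2 * \<bar>x\<bar>" if "s \<noteq> t" for s x
  proof -
    have "norm (fkern s x - (fkern t x + (s - t) *\<^sub>R (\<i> * of_real x * fkern t x)))
        \<le> norm (fkern s x - fkern t x) + norm ((s - t) *\<^sub>R (\<i> * of_real x * fkern t x))"
      by (metis diff_diff_eq norm_triangle_ineq4)
    also have "\<dots> \<le> \<bar>s - t\<bar> * \<bar>x\<bar> + \<bar>s - t\<bar> * \<bar>x\<bar>"
      by (intro add_mono fkern_diff_le) (simp add: norm_mult)
    finally have "norm (fkern s x - (fkern t x + (s - t) *\<^sub>R (\<i> * of_real x * fkern t x)))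
        \<le> (2 * \<bar>x\<bar>) * \<bar>s - t\<bar>" by (simp add: mult_ac)
    moreover have "norm (e s x) =
        norm (fkern s x - (fkern t x + (s - t) *\<^sub>R (\<i> * of_real x * fkern t x))) / \<bar>s - t\<bar>"
      unfolding e_def norm_scaleR by simp
    moreover have "\<bar>s - t\<bar> > 0" using that by simp
    ultimately show ?thesis by (simp only: pos_divide_le_eq)
  qed
  have e_lim: "((\<lambda>s. e s x) \<longlongrightarrow> 0) (at t)" for x
    using fkern_has_vector_derivative[of x t]
    unfolding has_vector_derivative_def has_derivative_at2 e_def by simp
  have "((\<lambda>s. c * (LBINT x. u x * e s x)) \<longlongrightarrow> 0) (at t)"
    unfolding tendsto_at_iff_sequentially o_def
  proof (intro allI impI)
    fix X :: "nat \<Rightarrow> real"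
    assume X: "\<forall>i. X i \<in> UNIV - {t}" "X \<longlonglongrightarrow> t"
    have "(\<lambda>i. LBINT x. u x * e (X i) x) \<longlonglongrightarrow> (LBINT x::real. 0)"
    proof (rule integral_dominated_convergence[where w = "\<lambda>x. 2 * norm (of_real x * u x)"])
      show "AE x in lborel. (\<lambda>i. u x * e (X i) x) \<longlonglongrightarrow> 0"
      proof (rule AE_I2)
        fix x :: real
        have "(\<lambda>i. e (X i) x) \<longlonglongrightarrow> 0"
          using e_lim[of x] X unfolding tendsto_at_iff_sequentially o_def by blast
        from tendsto_mult_left[OF this, of "u x"] show "(\<lambda>i. u x * e (X i) x) \<longlonglongrightarrow> 0" by simp
      qed
      show "integrable lborel (\<lambda>x. 2 * norm (of_real x * u x))"
        by (intro integrable_mult_right integrable_norm xu)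
      show "AE x in lborel. norm (u x * e (X i) x) \<le> 2 * norm (of_real x * u x)" for i
      proof (rule AE_I2)
        fix x
        have "norm (u x * e (X i) x) \<le> norm (u x) * (2 * \<bar>x\<bar>)"
          unfolding norm_mult using X by (intro mult_left_mono e_le) auto
        thus "norm (u x * e (X i) x) \<le> 2 * norm (of_real x * u x)"
          by (simp add: norm_mult mult_ac)
      qed
    qed auto
    from tendsto_mult_left[OF this, of c]
    show "(\<lambda>i. c * (LBINT x. u x * e (X i) x)) \<longlonglongrightarrow> 0" by simp
  qed
  thus ?thesis
    unfolding has_vector_derivative_def has_derivative_at2 quot
    by (simp add: bounded_linear_scaleR_left)
qed

lemma fourier_adj_smooth:
  assumes "\<And>n. integrable lborel (\<lambda>x. of_real x ^ n * u x)"
  shows "smooth_fun (fourier_adj u)"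
    and "nderiv n (fourier_adj u) = fourier_adj (\<lambda>x. (\<i> * of_real x) ^ n * u x)"
proof -
  define F where "F = (\<lambda>n. fourier_adj (\<lambda>x. (\<i> * of_real x) ^ n * u x))"
  have int: "integrable lborel (\<lambda>x. (\<i> * of_real x) ^ n * u x)" for n
    using integrable_mult_right[OF assms[of n], of "\<i> ^ n"]
    by (simp add: power_mult_distrib mult_ac)
  have "(F n has_vector_derivative F (Suc n) t) (at t)" for n t
  proof -
    have "integrable lborel (\<lambda>x. (-\<i>) * ((\<i> * of_real x) ^ Suc n * u x))"
      by (intro integrable_mult_right int)
    hence "integrable lborel (\<lambda>x. of_real x * ((\<i> * of_real x) ^ n * u x))"
      by (simp add: mult_ac)
    from fourier_adj_has_vector_derivative[OF int this, of t]
    show ?thesis by (simp add: F_def mult_ac)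
  qed
  from smooth_funI[of F, OF this] nderiv_eqI[of F, OF this]
  show "smooth_fun (fourier_adj u)"
    "nderiv n (fourier_adj u) = fourier_adj (\<lambda>x. (\<i> * of_real x) ^ n * u x)"
    by (auto simp: F_def)
qed

lemma integrable_pair_mult:
  fixes f g :: "real \<Rightarrow> complex"
  assumes f: "integrable lborel f" and g: "integrable lborel g"
  shows "integrable (lborel \<Otimes>\<^sub>M lborel) (\<lambda>(x, y). f x * g y)"
proof -
  have [measurable]: "f \<in> borel_measurable borel" "g \<in> borel_measurable borel"
    using borel_measurable_integrable[OF f] borel_measurable_integrable[OF g] by simp_all
  show ?thesis
  proof (rule lborel_pair.Fubini_integrable)
    show "integrable lborel (\<lambda>x. LBINT y. norm (case (x, y) of (x, y) \<Rightarrow> f x * g y))"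
      using f by (simp add: norm_mult)
    show "AE x in lborel. integrable lborel (\<lambda>y. case (x, y) of (x, y) \<Rightarrow> f x * g y)"
      using g by simp
  qed measurable
qed

text \<open>This form serves the concrete applications of Fubini below: a majorant that is a product
  of one integrable function in each variable.\<close>

lemma integrable_pair_bound:
  fixes f g :: "real \<Rightarrow> complex" and F :: "real \<Rightarrow> real \<Rightarrow> complex"
  assumes "integrable lborel f" "integrable lborel g"
    and "case_prod F \<in> borel_measurable (lborel \<Otimes>\<^sub>M lborel)"
    and "\<And>x y. norm (F x y) \<le> norm (f x) * norm (g y)"
  shows "integrable (lborel \<Otimes>\<^sub>M lborel) (case_prod F)"
proof (rule Bochner_Integration.integrable_bound[OF integrable_pair_mult[OF assms(1,2)]])
  show "AE p in lborel \<Otimes>\<^sub>M lborel. norm (case_prod F p) \<le> norm (case p of (x, y) \<Rightarrow> f x * g y)"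
    using assms(4) by (auto simp: norm_mult)
qed (rule assms(3))

section \<open>Gaussian integrals and Fourier inversion\<close>

lemma integrable_exp_neg_square: "integrable lborel (\<lambda>z::real. exp (- (z\<^sup>2 / 2)))"
proof -
  have "integrable lborel (\<lambda>z. sqrt (2 * pi) * std_normal_density z)"
    by (intro integrable_mult_right) simp
  thus ?thesis by (simp add: std_normal_density_def)
qed

lemma integral_exp_neg_square: "(LBINT z::real. exp (- (z\<^sup>2 / 2))) = sqrt (2 * pi)"
proof -
  have "(LBINT z. sqrt (2 * pi) * std_normal_density z) = sqrt (2 * pi)"
    by simp
  thus ?thesis by (simp add: std_normal_density_def)
qed

text \<open>The characteristic function of the standard normal distribution at s/\<epsilon>, after
  the substitution z = \<epsilon> \<xi>.\<close>

lemma integral_fkern_gaussian: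
  assumes "\<epsilon> > 0"
  shows "(LBINT \<xi>. fkern s \<xi> * of_real (exp (- ((\<epsilon> * \<xi>)\<^sup>2 / 2)))) =
           of_real (sqrt (2 * pi) / \<epsilon> * exp (- ((s / \<epsilon>)\<^sup>2 / 2)))"
proof -
  have "of_real (exp (- ((s / \<epsilon>)\<^sup>2 / 2))) = char std_normal_distribution (s / \<epsilon>)"
    by (simp add: char_std_normal_distribution)
  also have "\<dots> = (LBINT z. std_normal_density z *\<^sub>R iexp (s / \<epsilon> * z))"
    by (simp add: char_def integral_density)
  also have "\<dots> = \<epsilon> *\<^sub>R (LBINT \<xi>. std_normal_density (\<epsilon> * \<xi>) *\<^sub>R iexp (s / \<epsilon> * (\<epsilon> * \<xi>)))"
    using assms by (subst lborel_integral_real_affine[where c=\<epsilon> and t=0]) simp_all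
  also have "(LBINT \<xi>. std_normal_density (\<epsilon> * \<xi>) *\<^sub>R iexp (s / \<epsilon> * (\<epsilon> * \<xi>))) =
     (LBINT \<xi>. of_real (1 / sqrt (2 * pi)) * (fkern s \<xi> * of_real (exp (- ((\<epsilon> * \<xi>)\<^sup>2 / 2)))))"
    using assms by (intro Bochner_Integration.integral_cong refl)
      (simp add: std_normal_density_def scaleR_conv_of_real mult_ac)
  also have "\<dots> = of_real (1 / sqrt (2 * pi)) *
       (LBINT \<xi>. fkern s \<xi> * of_real (exp (- ((\<epsilon> * \<xi>)\<^sup>2 / 2))))"
    by (rule integral_mult_right_zero)
  finally show ?thesis using assms
    by (simp add: scaleR_conv_of_real field_simps)
qed

text \<open>Gaussian regularisation: \<open>\<epsilon> n\<close> is the width of the kernel with which \<open>u\<close> is smoothed.\<close>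

theorem fourier_inversion:
  assumes u: "integrable lborel u" and cont: "\<And>x. isCont u x"
    and bound: "\<And>x. norm (u x) \<le> M" and Fu: "integrable lborel (fourier u)"
  shows "fourier_adj (fourier u) x = u x"
proof -
  define \<epsilon> where "\<epsilon> = (\<lambda>n. 1 / real (Suc n))"
  define E where "E = (\<lambda>z::real. complex_of_real (exp (- (z\<^sup>2 / 2))))"
  define I where "I = (\<lambda>n. LBINT \<xi>. fourier u \<xi> * fkern x \<xi> * E (\<epsilon> n * \<xi>))"
  have \<epsilon>_pos: "\<epsilon> n > 0" for n by (simp add: \<epsilon>_def)
  have \<epsilon>_lim: "\<epsilon> \<longlonglongrightarrow> 0" unfolding \<epsilon>_def by (rule LIMSEQ_Suc[OF lim_1_over_n])
  have E_cont: "isCont E z" for z unfolding E_def by (intro continuous_intros) auto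
  have E_int: "integrable lborel E"
    unfolding E_def by (subst complex_of_real_integrable_eq) (rule integrable_exp_neg_square)
  have E_le: "norm (E z) \<le> 1" for z by (simp add: E_def)
  have [measurable]: "u \<in> borel_measurable borel" "fourier u \<in> borel_measurable borel"
      "E \<in> borel_measurable borel"
    using borel_measurable_integrable[OF u] borel_measurable_integrable[OF Fu]
      borel_measurable_integrable[OF E_int] by simp_all
  \<comment> \<open>The integrals \<open>I n\<close> are evaluated in two ways. Here the
    regularising factor tends to 1 and integrability of \<open>fourier u\<close> gives the
    majorant.\<close>
  have lim1: "I \<longlonglongrightarrow> (LBINT \<xi>. fourier u \<xi> * fkern x \<xi>)"
    unfolding I_def
  proof (rule integral_dominated_convergence[where w = "\<lambda>\<xi>. norm (fourier u \<xi>)"])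
    show "AE \<xi> in lborel. (\<lambda>n. fourier u \<xi> * fkern x \<xi> * E (\<epsilon> n * \<xi>)) \<longlonglongrightarrow> fourier u \<xi> * fkern x \<xi>"
    proof (rule AE_I2)
      fix \<xi>
      have "(\<lambda>n. E (\<epsilon> n * \<xi>)) \<longlonglongrightarrow> E (0 * \<xi>)"
        by (intro isCont_tendsto_compose[OF E_cont] tendsto_intros \<epsilon>_lim)
      from tendsto_mult_left[OF this, of "fourier u \<xi> * fkern x \<xi>"]
      show "(\<lambda>n. fourier u \<xi> * fkern x \<xi> * E (\<epsilon> n * \<xi>)) \<longlonglongrightarrow> fourier u \<xi> * fkern x \<xi>"
        by (simp add: E_def)
    qed
    show "AE \<xi> in lborel. norm (fourier u \<xi> * fkern x \<xi> * E (\<epsilon> n * \<xi>)) \<le> norm (fourier u \<xi>)" for n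
      using E_le by (auto simp: norm_mult intro!: mult_left_le)
  qed (use Fu in auto)
  have I_eq: "I n = (LBINT z. u (x + \<epsilon> n * z) * E z)" for n
  proof -
    have En: "integrable lborel (\<lambda>\<xi>. E (\<epsilon> n * \<xi>))"
      using lborel_integrable_real_affine[OF E_int, of "\<epsilon> n" 0] \<epsilon>_pos[of n] by simp
    have "I n = (LBINT \<xi>. (LBINT y. of_real (1 / sqrt (2 * pi)) *
                   (u y * fkern (x - y) \<xi> * E (\<epsilon> n * \<xi>))))"
      unfolding I_def
    proof (intro Bochner_Integration.integral_cong refl)
      fix \<xi>
      have "fourier u \<xi> * fkern x \<xi> * E (\<epsilon> n * \<xi>) = of_real (1 / sqrt (2 * pi)) *
              (fkern x \<xi> * E (\<epsilon> n * \<xi>) * (LBINT y. u y * exp (- (\<i> * of_real y * of_real \<xi>))))"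
        by (simp add: fourier_def mult_ac)
      also have "\<dots> = (LBINT y. of_real (1 / sqrt (2 * pi)) * (fkern x \<xi> * E (\<epsilon> n * \<xi>) *
                         (u y * exp (- (\<i> * of_real y * of_real \<xi>)))))"
        by (simp only: integral_mult_right_zero)
      also have "\<dots> = (LBINT y. of_real (1 / sqrt (2 * pi)) *
                         (u y * fkern (x - y) \<xi> * E (\<epsilon> n * \<xi>)))"
        by (intro Bochner_Integration.integral_cong refl)
           (simp add: algebra_simps exp_diff exp_minus field_simps)
      finally show "fourier u \<xi> * fkern x \<xi> * E (\<epsilon> n * \<xi>) =
         (LBINT y. of_real (1 / sqrt (2 * pi)) * (u y * fkern (x - y) \<xi> * E (\<epsilon> n * \<xi>)))" .
    qed
    \<comment> \<open>The factor \<open>E (\<epsilon> n * \<xi>)\<close> supplies integrability in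
      \<xi>; the bare product of \<open>u y\<close> with an exponential has none.\<close>
    also have "\<dots> = (LBINT y. (LBINT \<xi>. of_real (1 / sqrt (2 * pi)) *
                        (u y * fkern (x - y) \<xi> * E (\<epsilon> n * \<xi>))))"
    proof (rule lborel_pair.Fubini_integral, rule integrable_pair_bound[OF _ En])
      show "integrable lborel (\<lambda>y. of_real (1 / sqrt (2 * pi)) * u y)"
        by (intro integrable_mult_right u)
    qed (measurable, simp add: norm_mult norm_divide del: of_real_diff)
    also have "\<dots> = (LBINT y. u y * of_real (1 / \<epsilon> n * exp (- (((x - y) / \<epsilon> n)\<^sup>2 / 2))))"
    proof (intro Bochner_Integration.integral_cong refl)
      fix y
      have "(LBINT \<xi>. of_real (1 / sqrt (2 * pi)) * (u y * fkern (x - y) \<xi> * E (\<epsilon> n * \<xi>))) =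
            of_real (1 / sqrt (2 * pi)) * (u y * (LBINT \<xi>. fkern (x - y) \<xi> * E (\<epsilon> n * \<xi>)))"
        by (simp only: integral_mult_right_zero mult.assoc)
      also have "\<dots> = u y * of_real (1 / \<epsilon> n * exp (- (((x - y) / \<epsilon> n)\<^sup>2 / 2)))"
        unfolding E_def integral_fkern_gaussian[OF \<epsilon>_pos] by simp
      finally show "(LBINT \<xi>. of_real (1 / sqrt (2 * pi)) * (u y * fkern (x - y) \<xi> * E (\<epsilon> n * \<xi>))) = \<dots>" .
    qed
    \<comment> \<open>Substituting y = x + \<epsilon> z makes the Gaussian independent of n and
      moves the whole dependence on n into the argument of \<open>u\<close>, where continuity takes
      over.\<close>
    also have "\<dots> = \<epsilon> n *\<^sub>R (LBINT z. u (x + \<epsilon> n * z) *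
                   of_real (1 / \<epsilon> n * exp (- (((x - (x + \<epsilon> n * z)) / \<epsilon> n)\<^sup>2 / 2))))"
      using \<epsilon>_pos[of n] by (subst lborel_integral_real_affine[where c="\<epsilon> n" and t=x]) simp_all
    also have "\<dots> = (LBINT z. \<epsilon> n *\<^sub>R (u (x + \<epsilon> n * z) *
                   of_real (1 / \<epsilon> n * exp (- (((x - (x + \<epsilon> n * z)) / \<epsilon> n)\<^sup>2 / 2)))))"
      by (rule integral_scaleR_right[symmetric])
    also have "\<dots> = (LBINT z. u (x + \<epsilon> n * z) * E z)"
      using \<epsilon>_pos[of n]
      by (intro Bochner_Integration.integral_cong refl) (simp add: E_def scaleR_conv_of_real)
    finally show ?thesis .
  qed
  have "(\<lambda>n. LBINT z. u (x + \<epsilon> n * z) * E z) \<longlonglongrightarrow> (LBINT z. u x * E z)"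
  proof (rule integral_dominated_convergence[where w = "\<lambda>z. M * norm (E z)"])
    show "AE z in lborel. (\<lambda>n. u (x + \<epsilon> n * z) * E z) \<longlonglongrightarrow> u x * E z"
    proof (rule AE_I2)
      fix z
      have "(\<lambda>n. u (x + \<epsilon> n * z)) \<longlonglongrightarrow> u (x + 0 * z)"
        by (intro isCont_tendsto_compose[OF cont] tendsto_intros \<epsilon>_lim)
      from tendsto_mult_right[OF this, of "E z"]
      show "(\<lambda>n. u (x + \<epsilon> n * z) * E z) \<longlonglongrightarrow> u x * E z" by simp
    qed
    show "integrable lborel (\<lambda>z. M * norm (E z))"
      by (intro integrable_mult_right integrable_norm E_int)
    show "AE z in lborel. norm (u (x + \<epsilon> n * z) * E z) \<le> M * norm (E z)" for n
      using bound by (auto simp: norm_mult intro!: mult_right_mono)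
  qed auto
  moreover have "I = (\<lambda>n. LBINT z. u (x + \<epsilon> n * z) * E z)"
    using I_eq by blast
  ultimately have "I \<longlonglongrightarrow> u x * (LBINT z. E z)"
    by simp
  moreover have "(LBINT z. E z) = of_real (sqrt (2 * pi))"
    unfolding E_def by (simp add: integral_exp_neg_square)
  ultimately have "(LBINT \<xi>. fourier u \<xi> * fkern x \<xi>) = u x * of_real (sqrt (2 * pi))"
    using LIMSEQ_unique[OF lim1] by simp
  thus ?thesis by (simp add: fourier_adj_def)
qed

section \<open>The Paley--Wiener correspondence\<close>

lemma integrable_inverse_1_plus_square_UNIV:
  "integrable lborel (\<lambda>x::real. inverse (1 + x\<^sup>2))"
  using integrable_inverse_1_plus_square by (simp add: set_integrable_def)

text \<open>
  The integrals of \<open>F\<close> over truncations of two horizontal lines are increments of a primitive of \<open>F\<close>; their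
  difference is controlled by the increments over the two short vertical segments.
\<close>

lemma integral_shift_line:
  fixes F :: "complex \<Rightarrow> complex"
  assumes F: "F holomorphic_on UNIV"
    and bound: "\<And>z. \<bar>Im z\<bar> \<le> \<bar>y\<bar> \<Longrightarrow> norm (F z) \<le> K * inverse (1 + (Re z)\<^sup>2)"
  shows "(LBINT x. F (of_real x)) = (LBINT x. F (of_real x + \<i> * of_real y))"
proof -
  obtain P where P: "\<And>z. (P has_field_derivative F z) (at z)"
    using holomorphic_convex_primitive'[OF convex_UNIV open_UNIV F] by auto
  have contF: "continuous_on UNIV F" by (rule holomorphic_on_imp_continuous_on[OF F])
  define Q where "Q = (\<lambda>s x. P (of_real x + \<i> * of_real s))"
  have FTC: "(LBINT x. indicator {-R..R} x *\<^sub>R F (of_real x + \<i> * of_real s)) = Q s R - Q s (-R)"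
    if "R \<ge> 0" for R s
  proof (rule integral_FTC_Icc)
    fix x :: real
    have "((\<lambda>x. of_real x + \<i> * of_real s) has_vector_derivative 1) (at x within {-R..R})"
      by (auto intro!: derivative_eq_intros has_vector_derivative_real_field)
    from field_vector_diff_chain_within[OF this, of P] DERIV_subset[OF P]
    show "(Q s has_vector_derivative F (of_real x + \<i> * of_real s)) (at x within {-R..R})"
      by (force simp: o_def Q_def)
  next
    show "continuous_on {-R..R} (\<lambda>x. F (of_real x + \<i> * of_real s))"
      by (intro continuous_intros continuous_on_compose2[OF contF]) auto
  qed (use that in auto)
  have lim: "(\<lambda>n. LBINT x. indicator {-real n..real n} x *\<^sub>R F (of_real x + \<i> * of_real s))
                \<longlonglongrightarrow> (LBINT x. F (of_real x + \<i> * of_real s))" if "\<bar>s\<bar> \<le> \<bar>y\<bar>" for s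
  proof (rule integral_dominated_convergence[where w = "\<lambda>x. K * inverse (1 + x\<^sup>2)"])
    show meas: "(\<lambda>x. F (of_real x + \<i> * of_real s)) \<in> borel_measurable lborel"
      by (simp, intro borel_measurable_continuous_onI continuous_intros
            continuous_on_compose2[OF contF]) auto
    thus "(\<lambda>x. indicator {-real n..real n} x *\<^sub>R F (of_real x + \<i> * of_real s)) \<in> borel_measurable lborel" for n
      by measurable
    show "integrable lborel (\<lambda>x. K * inverse (1 + x\<^sup>2))"
      by (intro integrable_mult_right integrable_inverse_1_plus_square_UNIV)
    show "AE x in lborel. norm (indicator {-real n..real n} x *\<^sub>R F (of_real x + \<i> * of_real s))
            \<le> K * inverse (1 + x\<^sup>2)" for n
    proof (rule AE_I2)
      fix x
      have "norm (F (of_real x + \<i> * of_real s)) \<le> K * inverse (1 + x\<^sup>2)"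
        using bound[of "of_real x + \<i> * of_real s"] that by simp
      moreover from this have "0 \<le> K * inverse (1 + x\<^sup>2)"
        by (rule order_trans[OF norm_ge_zero])
      ultimately show "norm (indicator {-real n..real n} x *\<^sub>R F (of_real x + \<i> * of_real s))
            \<le> K * inverse (1 + x\<^sup>2)" by (simp add: indicator_def)
    qed
    show "AE x in lborel. (\<lambda>n. indicator {-real n..real n} x *\<^sub>R F (of_real x + \<i> * of_real s))
             \<longlonglongrightarrow> F (of_real x + \<i> * of_real s)"
    proof (rule AE_I2)
      fix x :: real
      have "eventually (\<lambda>n. indicator {-real n..real n} x *\<^sub>R F (of_real x + \<i> * of_real s) =
              F (of_real x + \<i> * of_real s)) sequentially"
        using eventually_ge_at_top[of "nat \<lceil>\<bar>x\<bar>\<rceil>"]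
      proof eventually_elim
        case (elim n)
        hence "\<bar>x\<bar> \<le> real n" by linarith
        thus ?case by (simp add: indicator_def abs_le_iff)
      qed
      thus "(\<lambda>n. indicator {-real n..real n} x *\<^sub>R F (of_real x + \<i> * of_real s))
             \<longlonglongrightarrow> F (of_real x + \<i> * of_real s)"
        by (rule tendsto_eventually)
    qed
  qed
  have vert: "norm (Q y R - Q 0 R) \<le> \<bar>y\<bar> * (K * inverse (1 + R\<^sup>2))" for R
  proof -
    define S where "S = closed_segment (complex_of_real R) (of_real R + \<i> * of_real y)"
    have S: "Re z = R" "\<bar>Im z\<bar> \<le> \<bar>y\<bar>" if "z \<in> S" for z
    proof -
      from that obtain t where t: "0 \<le> t" "t \<le> 1"
          "z = (1 - t) *\<^sub>R of_real R + t *\<^sub>R (of_real R + \<i> * of_real y)"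
        unfolding S_def in_segment by blast
      show "Re z = R" using t(3) by (simp add: algebra_simps)
      have "\<bar>Im z\<bar> = t * \<bar>y\<bar>" using t by (simp add: abs_mult)
      also have "\<dots> \<le> 1 * \<bar>y\<bar>" using t by (intro mult_right_mono) auto
      finally show "\<bar>Im z\<bar> \<le> \<bar>y\<bar>" by simp
    qed
    have "norm (P (of_real R + \<i> * of_real y) - P (of_real R)) \<le>
            (K * inverse (1 + R\<^sup>2)) * norm ((of_real R + \<i> * of_real y) - complex_of_real R)"
    proof (rule field_differentiable_bound[of S])
      show "(P has_field_derivative F z) (at z within S)" if "z \<in> S" for z
        by (rule DERIV_subset[OF P]) auto
      show "norm (F z) \<le> K * inverse (1 + R\<^sup>2)" if "z \<in> S" for z
        using bound[of z] S[OF that] by auto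
    qed (auto simp: S_def)
    thus ?thesis by (simp add: Q_def norm_mult mult_ac)
  qed
  have "(\<lambda>n. \<bar>y\<bar> * (K * inverse (1 + (real n)\<^sup>2))) \<longlonglongrightarrow> \<bar>y\<bar> * (K * 0)"
    by (intro tendsto_intros tendsto_inverse_0_at_top filterlim_tendsto_add_at_top[OF tendsto_const]
          filterlim_pow_at_top filterlim_real_sequentially) simp
  hence lim0: "(\<lambda>n. \<bar>y\<bar> * (K * inverse (1 + (real n)\<^sup>2))) \<longlonglongrightarrow> 0" by simp
  have v1: "(\<lambda>n. Q y (real n) - Q 0 (real n)) \<longlonglongrightarrow> 0"
    by (rule Lim_null_comparison[OF _ lim0]) (use vert in auto)
  have v2: "(\<lambda>n. Q y (- real n) - Q 0 (- real n)) \<longlonglongrightarrow> 0"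
    by (rule Lim_null_comparison[OF _ lim0]) (use vert[of "- real _"] in auto)
  have "(\<lambda>n. (Q y (real n) - Q y (- real n)) - (Q 0 (real n) - Q 0 (- real n)))
          \<longlonglongrightarrow> (LBINT x. F (of_real x + \<i> * of_real y)) - (LBINT x. F (of_real x + \<i> * of_real 0))"
    using tendsto_diff[OF lim[of y] lim[of 0]] by (simp only: FTC of_nat_0_le_iff abs_ge_zero abs_zero order_refl)
  moreover have "(\<lambda>n. (Q y (real n) - Q y (- real n)) - (Q 0 (real n) - Q 0 (- real n))) \<longlonglongrightarrow> 0"
    using tendsto_diff[OF v1 v2] by (simp add: algebra_simps)
  ultimately show ?thesis
    using LIMSEQ_unique by fastforce
qed

section \<open>Decay in Z and the direct half of Paley-Wiener\<close>

lemma Z_space_extension: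
  assumes "u \<in> Z_space"
  obtains \<psi> r where "\<psi> holomorphic_on UNIV" "\<And>x. \<psi> (of_real x) = u x" "r > 0"
    "\<And>n. \<exists>C\<ge>0. \<forall>z. norm (\<psi> z) \<le> C * inverse ((1 + norm z) ^ n) * exp (r * \<bar>Im z\<bar>)"
proof -
  obtain \<psi> r where \<psi>: "\<psi> holomorphic_on UNIV" "\<And>x. \<psi> (of_real x) = u x" "r > 0" and
    C: "\<And>n. \<exists>C. \<forall>z. norm (\<psi> z) \<le> C * inverse ((1 + norm z) ^ n) * exp (r * \<bar>Im z\<bar>)"
    using assms unfolding Z_space_def by blast
  show ?thesis
  proof (rule that[OF \<psi>])
    fix n
    obtain C where C: "\<And>z. norm (\<psi> z) \<le> C * inverse ((1 + norm z) ^ n) * exp (r * \<bar>Im z\<bar>)"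
      using C by blast
    from C[of 0] have "C \<ge> 0" using order_trans[OF norm_ge_zero] by fastforce
    with C show "\<exists>C\<ge>0. \<forall>z. norm (\<psi> z) \<le> C * inverse ((1 + norm z) ^ n) * exp (r * \<bar>Im z\<bar>)"
      by blast
  qed
qed

lemma inverse_square_le: "inverse ((1 + norm z)\<^sup>2) \<le> inverse (1 + (Re z)\<^sup>2)"
proof (rule le_imp_inverse_le)
  have "(Re z)\<^sup>2 \<le> (norm z)\<^sup>2"
    using abs_Re_le_cmod[of z] by (metis abs_le_square_iff abs_norm_cancel)
  moreover have "(1 + norm z)\<^sup>2 = 1 + (norm z)\<^sup>2 + 2 * norm z"
    by (simp add: power2_sum)
  ultimately show "1 + (Re z)\<^sup>2 \<le> (1 + norm z)\<^sup>2"
    using norm_ge_zero[of z] by linarith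
  show "0 < 1 + (Re z)\<^sup>2" by (simp add: add_pos_nonneg)
qed

lemma Z_space_isCont:
  assumes "u \<in> Z_space"
  shows "isCont u x"
proof -
  obtain \<psi> where \<psi>: "\<psi> holomorphic_on UNIV" "\<And>x. \<psi> (of_real x) = u x"
    using Z_space_extension[OF assms] by metis
  have "continuous_on UNIV (\<lambda>x::real. \<psi> (of_real x))"
    by (intro continuous_on_compose2[OF holomorphic_on_imp_continuous_on[OF \<psi>(1)]]
          continuous_intros) auto
  thus ?thesis by (simp add: \<psi>(2) continuous_on_eq_continuous_at)
qed

lemma Z_space_decay:
  assumes "u \<in> Z_space"
  obtains C where "C \<ge> 0" "\<And>x. norm (of_real x ^ n * u x) \<le> C * inverse (1 + x\<^sup>2)"
proof -
  obtain \<psi> r where \<psi>: "\<And>x. \<psi> (of_real x) = u x"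
    "\<And>n. \<exists>C\<ge>0. \<forall>z. norm (\<psi> z) \<le> C * inverse ((1 + norm z) ^ n) * exp (r * \<bar>Im z\<bar>)"
    using Z_space_extension[OF assms] by metis
  \<comment> \<open>Of the n + 2 powers, n absorb the factor x^n and the other two leave an
    integrable function.\<close>
  then obtain C where C: "C \<ge> 0"
    "\<And>z. norm (\<psi> z) \<le> C * inverse ((1 + norm z) ^ (n + 2)) * exp (r * \<bar>Im z\<bar>)"
    by metis
  have "norm (of_real x ^ n * u x) \<le> C * inverse (1 + x\<^sup>2)" for x
  proof -
    have "norm (u x) \<le> C * inverse ((1 + \<bar>x\<bar>) ^ (n + 2))"
      using C(2)[of "of_real x"] by (simp add: \<psi>(1))
    hence "norm (of_real x ^ n * u x) \<le> (1 + \<bar>x\<bar>) ^ n * (C * inverse ((1 + \<bar>x\<bar>) ^ (n + 2)))"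
      unfolding norm_mult norm_power by (intro mult_mono power_mono) auto
    moreover have "a ^ n * (C * inverse (a ^ (n + 2))) = C * inverse (a\<^sup>2)" if "a > 0" for a
      using that by (simp add: power_add power2_eq_square field_simps)
    moreover have "C * inverse ((1 + \<bar>x\<bar>)\<^sup>2) \<le> C * inverse (1 + x\<^sup>2)"
      using inverse_square_le[of "of_real x"] C(1) by (intro mult_left_mono) auto
    ultimately show ?thesis by (metis abs_ge_zero add_pos_nonneg order_trans zero_less_one)
  qed
  with C(1) that show ?thesis by blast
qed

lemma Z_space_integrable:
  assumes "u \<in> Z_space"
  shows "integrable lborel (\<lambda>x. of_real x ^ n * u x)"
proof -
  obtain C where C: "C \<ge> 0" "\<And>x. norm (of_real x ^ n * u x) \<le> C * inverse (1 + x\<^sup>2)"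
    using Z_space_decay[OF assms] by blast
  have [measurable]: "u \<in> borel_measurable borel"
    using Z_space_isCont[OF assms]
    by (intro borel_measurable_continuous_onI continuous_at_imp_continuous_on) auto
  have "integrable lborel (\<lambda>x::real. C * inverse (1 + x\<^sup>2))"
    by (intro integrable_mult_right integrable_inverse_1_plus_square_UNIV)
  thus ?thesis
  proof (rule Bochner_Integration.integrable_bound)
    show "AE x in lborel. norm (of_real x ^ n * u x) \<le> norm (C * inverse (1 + x\<^sup>2))"
      unfolding real_norm_def by (intro AE_I2 order_trans[OF C(2) abs_ge_self])
  qed measurable
qed

text \<open>
  The line of integration is moved by an arbitrary amount \<open>y\<close> with sign opposite to that of \<open>\<xi>\<close>.
\<close>

lemma fourier_Z_space_eq_0:
  assumes \<psi>: "\<psi> holomorphic_on UNIV" and r: "r > 0"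
    and C: "\<And>z. norm (\<psi> z) \<le> C * inverse ((1 + norm z)\<^sup>2) * exp (r * \<bar>Im z\<bar>)"
    and \<xi>: "r < \<bar>\<xi>\<bar>"
  shows "fourier (\<lambda>x. \<psi> (of_real x)) \<xi> = 0"
proof -
  define F where "F = (\<lambda>z. \<psi> z * exp (- (\<i> * z * of_real \<xi>)))"
  have C0: "C \<ge> 0" using C[of 0] order_trans[OF norm_ge_zero] by fastforce
  have F_le: "norm (F z) \<le> C * exp (r * \<bar>Im z\<bar> + Im z * \<xi>) * inverse (1 + (Re z)\<^sup>2)" for z
  proof -
    have "norm (F z) = norm (\<psi> z) * exp (Im z * \<xi>)"
      by (simp add: F_def norm_mult norm_exp_eq_Re)
    also have "\<dots> \<le> (C * inverse ((1 + norm z)\<^sup>2) * exp (r * \<bar>Im z\<bar>)) * exp (Im z * \<xi>)"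
      by (intro mult_right_mono C) auto
    also have "\<dots> = (C * exp (r * \<bar>Im z\<bar> + Im z * \<xi>)) * inverse ((1 + norm z)\<^sup>2)"
      by (simp add: exp_add)
    also have "\<dots> \<le> (C * exp (r * \<bar>Im z\<bar> + Im z * \<xi>)) * inverse (1 + (Re z)\<^sup>2)"
      using C0 by (intro mult_left_mono inverse_square_le) auto
    finally show ?thesis .
  qed
  define A where "A = (LBINT x::real. inverse (1 + x\<^sup>2))"
  have main: "norm (LBINT x. F (of_real x)) \<le> C * exp (r * \<bar>y\<bar> + y * \<xi>) * A" for y
  proof -
    have "(LBINT x. F (of_real x)) = (LBINT x. F (of_real x + \<i> * of_real y))"
    proof (rule integral_shift_line)
      show "F holomorphic_on UNIV" unfolding F_def by (intro holomorphic_intros \<psi>)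
      fix z assume z: "\<bar>Im z\<bar> \<le> \<bar>y\<bar>"
      \<comment> \<open>\<open>integral_shift_line\<close> asks for one constant on the whole strip,
        so a crude bound is enough here. The sharp one is used afterwards, on the shifted line
        only.\<close>
      have "Im z * \<xi> \<le> \<bar>Im z\<bar> * \<bar>\<xi>\<bar>" by (metis abs_ge_self abs_mult)
      also have "\<dots> \<le> \<bar>y\<bar> * \<bar>\<xi>\<bar>" using z by (intro mult_right_mono) auto
      finally have "r * \<bar>Im z\<bar> + Im z * \<xi> \<le> r * \<bar>y\<bar> + \<bar>y\<bar> * \<bar>\<xi>\<bar>"
        using z r by (intro add_mono mult_left_mono) auto
      hence "C * exp (r * \<bar>Im z\<bar> + Im z * \<xi>) * inverse (1 + (Re z)\<^sup>2) \<le>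
               C * exp (r * \<bar>y\<bar> + \<bar>y\<bar> * \<bar>\<xi>\<bar>) * inverse (1 + (Re z)\<^sup>2)"
        using C0 by (intro mult_right_mono mult_left_mono) auto
      with F_le[of z] show "norm (F z) \<le> C * exp (r * \<bar>y\<bar> + \<bar>y\<bar> * \<bar>\<xi>\<bar>) * inverse (1 + (Re z)\<^sup>2)"
        by (rule order_trans)
    qed
    also have "norm \<dots> \<le> (LBINT x. norm (F (of_real x + \<i> * of_real y)))"
      by (rule integral_norm_bound)
    also have "\<dots> \<le> (LBINT x. C * exp (r * \<bar>y\<bar> + y * \<xi>) * inverse (1 + x\<^sup>2))"
    proof (rule integral_mono)
      show int: "integrable lborel (\<lambda>x. C * exp (r * \<bar>y\<bar> + y * \<xi>) * inverse (1 + x\<^sup>2))"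
        by (intro integrable_mult_right integrable_inverse_1_plus_square_UNIV)
      show le: "norm (F (of_real x + \<i> * of_real y)) \<le> C * exp (r * \<bar>y\<bar> + y * \<xi>) * inverse (1 + x\<^sup>2)" for x
        using F_le[of "of_real x + \<i> * of_real y"] by simp
      show "integrable lborel (\<lambda>x. norm (F (of_real x + \<i> * of_real y)))"
      proof (rule integrable_norm, rule Bochner_Integration.integrable_bound[OF int])
        have "continuous_on UNIV F"
          unfolding F_def by (intro holomorphic_on_imp_continuous_on holomorphic_intros \<psi>)
        thus "(\<lambda>x. F (of_real x + \<i> * of_real y)) \<in> borel_measurable lborel"
          by (simp, intro borel_measurable_continuous_onI)
             (rule continuous_on_compose2[of UNIV F], auto intro!: continuous_intros)
        show "AE x in lborel. norm (F (of_real x + \<i> * of_real y)) \<le>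
                 norm (C * exp (r * \<bar>y\<bar> + y * \<xi>) * inverse (1 + x\<^sup>2))"
          unfolding real_norm_def by (intro AE_I2 order_trans[OF le abs_ge_self])
      qed
    qed
    also have "\<dots> = C * exp (r * \<bar>y\<bar> + y * \<xi>) * A" by (simp add: A_def)
    finally show ?thesis .
  qed
  \<comment> \<open>With y = - sgn(\<xi>) n the exponent r |y| + y \<xi> becomes - (|\<xi>| - r) n,
    which tends to minus infinity since |\<xi>| > r.\<close>
  have "(\<lambda>n. C * exp (- ((\<bar>\<xi>\<bar> - r) * real n)) * A) \<longlonglongrightarrow> C * 0 * A"
    using \<xi> by (intro tendsto_intros filterlim_compose[OF exp_at_bot] filterlim_uminus_at_top[THEN iffD1]
        filterlim_tendsto_pos_mult_at_top[OF tendsto_const] filterlim_real_sequentially) auto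
  moreover have "norm (LBINT x. F (of_real x)) \<le> C * exp (- ((\<bar>\<xi>\<bar> - r) * real n)) * A" for n
    using main[of "- sgn \<xi> * real n"] \<xi> r
    by (cases "\<xi> > 0") (auto simp: abs_mult sgn_if algebra_simps abs_if split: if_splits)
  ultimately have "norm (LBINT x. F (of_real x)) \<le> 0"
    using LIMSEQ_le_const by fastforce
  thus ?thesis by (simp add: fourier_def F_def)
qed

text \<open>The exponential type r of the entire extension bounds the support of the transform, and
  integrability of all moments gives its smoothness. The transform is then itself integrable, as
  inversion requires.\<close>

theorem fourier_Z_space:
  assumes u: "u \<in> Z_space"
  shows "fourier u \<in> test_funs" and "fourier_adj (fourier u) = u"
proof -
  obtain \<psi> r where \<psi>: "\<psi> holomorphic_on UNIV" "\<And>x. \<psi> (of_real x) = u x" "r > 0"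
    and C: "\<And>n. \<exists>C\<ge>0. \<forall>z. norm (\<psi> z) \<le> C * inverse ((1 + norm z) ^ n) * exp (r * \<bar>Im z\<bar>)"
    using Z_space_extension[OF u] by metis
  obtain C where "\<And>z. norm (\<psi> z) \<le> C * inverse ((1 + norm z)\<^sup>2) * exp (r * \<bar>Im z\<bar>)"
    using C by metis
  from fourier_Z_space_eq_0[OF \<psi>(1,3) this] have "\<forall>\<xi>. r < \<bar>\<xi>\<bar> \<longrightarrow> fourier u \<xi> = 0"
    by (simp add: \<psi>(2))
  moreover have "smooth_fun (fourier u)"
  proof -
    have "integrable lborel (\<lambda>x. of_real x ^ n * u (- x))" for n
    proof -
      have *: "(-1) ^ n * (of_real (0 + -1 * x) ^ n * u (0 + -1 * x)) = of_real x ^ n * u (- x)" for x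
        using power_mult_distrib[of "-1" "complex_of_real (- x)" n] by simp
      show ?thesis
        using integrable_mult_right[OF lborel_integrable_real_affine[OF Z_space_integrable[OF u, of n],
          of "-1" 0], of "(-1) ^ n"] by (simp only: * neg_equal_0_iff_equal one_neq_zero not_False_eq_True)
    qed
    from fourier_adj_smooth(1)[OF this] show ?thesis
      by (simp add: fourier_conv_adj_reflect[abs_def])
  qed
  ultimately show test: "fourier u \<in> test_funs"
    using \<psi>(3) by (auto simp: test_funs_iff)
  obtain M where "M \<ge> 0" and M: "\<And>x. norm (u x) \<le> M * inverse (1 + x\<^sup>2)"
    using Z_space_decay[OF u, of 0] by auto
  have "norm (u x) \<le> M" for x
  proof -
    have "inverse (1 + x\<^sup>2) \<le> inverse 1" by (intro le_imp_inverse_le) auto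
    from mult_left_mono[OF this \<open>M \<ge> 0\<close>] M[of x] show ?thesis by simp
  qed
  moreover have "integrable lborel u" using Z_space_integrable[OF u, of 0] by simp
  ultimately show "fourier_adj (fourier u) = u"
    using fourier_inversion[OF _ Z_space_isCont[OF u] _ test_funs_integrable[OF test]] by blast
qed

section \<open>Fourier-Laplace integrals and the converse half of Paley-Wiener\<close>

definition fourier_laplace :: "(real \<Rightarrow> complex) \<Rightarrow> complex \<Rightarrow> complex" where
  "fourier_laplace g z = (LBINT \<xi>. g \<xi> * exp (\<i> * z * of_real \<xi>))"

text \<open>Up to normalisation, \<open>fourier_laplace g\<close> is the entire continuation of
  \<open>fourier_adj g\<close> that membership in \<open>Z_space\<close> demands.\<close>

lemma fourier_adj_conv_laplace:
  "fourier_adj g x = of_real (1 / sqrt (2 * pi)) * fourier_laplace g (of_real x)"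
  by (simp add: fourier_adj_def fourier_laplace_def)

lemma test_funs_mult_cont_integrable:
  assumes "g \<in> test_funs" and f: "continuous_on UNIV f"
  shows "integrable lborel (\<lambda>x. g x * f x)"
proof -
  obtain r where g: "r > 0" "\<And>x. r < \<bar>x\<bar> \<Longrightarrow> g x = 0"
    using assms(1) by (auto simp: test_funs_iff)
  have "set_integrable lborel {-r..r} (\<lambda>x. g x * f x)"
    by (intro borel_integrable_atLeastAtMost' continuous_intros test_funs_continuous_on assms(1)
          continuous_on_subset[OF f]) auto
  moreover have "(\<lambda>x. indicator {-r..r} x *\<^sub>R (g x * f x)) = (\<lambda>x. g x * f x)"
    using g by (auto simp: fun_eq_iff indicator_def)
  ultimately show ?thesis by (simp add: set_integrable_def)
qed

text \<open>The compact support replaces the line by a compact interval, on which the Leibniz rule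
  for parameter integrals applies; the Henstock-Kurzweil integral there is then converted back to
  the Lebesgue integral.\<close>

lemma fourier_laplace_holomorphic:
  assumes "g \<in> test_funs"
  shows "fourier_laplace g holomorphic_on UNIV"
proof -
  obtain r where g: "r > 0" "\<And>x. r < \<bar>x\<bar> \<Longrightarrow> g x = 0"
    using assms by (auto simp: test_funs_iff)
  have cont: "continuous_on A g" for A by (rule test_funs_continuous_on[OF assms])
  have "(\<lambda>z. integral (cbox (-r) r) (\<lambda>\<xi>. g \<xi> * exp (\<i> * z * of_real \<xi>))) holomorphic_on UNIV"
  proof (rule leibniz_rule_holomorphic)
    fix z :: complex and t :: real
    show "((\<lambda>z. g t * exp (\<i> * z * of_real t)) has_field_derivative
            g t * (\<i> * of_real t * exp (\<i> * z * of_real t))) (at z within UNIV)"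
      by (auto intro!: derivative_eq_intros)
  next
    fix z :: complex
    show "(\<lambda>\<xi>. g \<xi> * exp (\<i> * z * of_real \<xi>)) integrable_on cbox (-r) r"
      by (intro integrable_continuous continuous_intros cont)
  next
    show "continuous_on (UNIV \<times> cbox (-r) r)
            (\<lambda>(z, t). g t * (\<i> * of_real t * exp (\<i> * z * of_real t)))"
      unfolding case_prod_unfold
      by (intro continuous_intros continuous_on_compose2[OF cont[of UNIV]]) auto
  qed auto
  moreover have "integral (cbox (-r) r) (\<lambda>\<xi>. g \<xi> * exp (\<i> * z * of_real \<xi>)) = fourier_laplace g z" for z
  proof -
    have "set_integrable lborel {-r..r} (\<lambda>\<xi>. g \<xi> * exp (\<i> * z * of_real \<xi>))"
      by (intro borel_integrable_atLeastAtMost' continuous_intros cont)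
    from set_borel_integral_eq_integral(2)[OF this]
    have "integral (cbox (-r) r) (\<lambda>\<xi>. g \<xi> * exp (\<i> * z * of_real \<xi>)) =
            (LBINT \<xi>. indicator {-r..r} \<xi> *\<^sub>R (g \<xi> * exp (\<i> * z * of_real \<xi>)))"
      by (simp add: set_lebesgue_integral_def)
    also have "\<dots> = fourier_laplace g z"
      unfolding fourier_laplace_def
      using g by (intro Bochner_Integration.integral_cong) (auto simp: indicator_def)
    finally show ?thesis .
  qed
  ultimately show ?thesis by simp
qed

lemma norm_fourier_laplace_le:
  assumes "g \<in> test_funs" and r: "\<And>x. r < \<bar>x\<bar> \<Longrightarrow> g x = 0"
  shows "norm (fourier_laplace g z) \<le> (LBINT \<xi>. norm (g \<xi>)) * exp (r * \<bar>Im z\<bar>)"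
proof -
  have "norm (fourier_laplace g z) \<le> (LBINT \<xi>. norm (g \<xi> * exp (\<i> * z * of_real \<xi>)))"
    unfolding fourier_laplace_def by (rule integral_norm_bound)
  also have "\<dots> \<le> (LBINT \<xi>. norm (g \<xi>) * exp (r * \<bar>Im z\<bar>))"
  proof (rule integral_mono)
    show "integrable lborel (\<lambda>\<xi>. norm (g \<xi> * exp (\<i> * z * of_real \<xi>)))"
      by (intro integrable_norm test_funs_mult_cont_integrable assms(1) continuous_intros)
    show "integrable lborel (\<lambda>\<xi>. norm (g \<xi>) * exp (r * \<bar>Im z\<bar>))"
      by (intro integrable_mult_left integrable_norm test_funs_integrable assms(1))
    show "norm (g \<xi> * exp (\<i> * z * of_real \<xi>)) \<le> norm (g \<xi>) * exp (r * \<bar>Im z\<bar>)" for \<xi>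
    proof (cases "r < \<bar>\<xi>\<bar>")
      case False
      have "- (Im z * \<xi>) \<le> \<bar>Im z\<bar> * \<bar>\<xi>\<bar>"
        by (metis abs_ge_self abs_minus_cancel abs_mult)
      also have "\<dots> \<le> \<bar>Im z\<bar> * r" using False by (intro mult_left_mono) auto
      finally show ?thesis
        by (simp add: norm_mult norm_exp_eq_Re mult_left_mono mult_ac)
    qed (use r in simp)
  qed
  also have "\<dots> = (LBINT \<xi>. norm (g \<xi>)) * exp (r * \<bar>Im z\<bar>)" by simp
  finally show ?thesis .
qed

text \<open>Integration by parts, carried out as the fundamental theorem for g(x) e^(izx), whose
  boundary values vanish.\<close>

lemma fourier_laplace_nderiv_Suc:
  assumes "g \<in> test_funs"
  shows "\<i> * fourier_laplace (nderiv (Suc 0) g) z = z * fourier_laplace g z"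
proof -
  let ?g' = "nderiv (Suc 0) g"
  have g': "?g' \<in> test_funs" by (rule nderiv_test_funs[OF assms])
  obtain r1 where r1: "r1 > 0" "\<And>x. r1 < \<bar>x\<bar> \<Longrightarrow> g x = 0"
    using assms by (auto simp: test_funs_iff)
  obtain r2 where r2: "r2 > 0" "\<And>x. r2 < \<bar>x\<bar> \<Longrightarrow> ?g' x = 0"
    using g' unfolding test_funs_iff by blast
  \<comment> \<open>Strictly larger than both radii: the vanishing of \<open>g\<close> is known only
    beyond \<open>r1\<close>, and it is needed at the end points R and -R themselves.\<close>
  define R where "R = r1 + r2"
  have R: "R > 0" "r1 < R" "r2 < R" using r1 r2 by (auto simp: R_def)
  define k where "k = (\<lambda>x. ?g' x * exp (\<i> * z * of_real x) + \<i> * z * (g x * exp (\<i> * z * of_real x)))"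
  have "(LBINT x. indicator {-R..R} x *\<^sub>R k x) =
          g R * exp (\<i> * z * of_real R) - g (-R) * exp (\<i> * z * of_real (-R))"
  proof (rule integral_FTC_Icc)
    fix x :: real
    have "(g has_vector_derivative ?g' x) (at x)"
      using smooth_fun_has_nderiv[of g 0 x] assms by (simp add: test_funs_iff)
    moreover have "((\<lambda>x. exp (\<i> * z * of_real x)) has_vector_derivative
                      \<i> * z * exp (\<i> * z * of_real x)) (at x)"
    proof -
      have "((\<lambda>x. \<i> * z * of_real x) has_vector_derivative \<i> * z) (at x)"
        by (auto intro!: derivative_eq_intros has_vector_derivative_real_field)
      from field_vector_diff_chain_at[OF this, of exp "exp (\<i> * z * of_real x)"]
      show ?thesis by (auto simp: o_def intro: DERIV_exp)
    qed
    ultimately have "((\<lambda>x. g x * exp (\<i> * z * of_real x)) has_vector_derivative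
        g x * (\<i> * z * exp (\<i> * z * of_real x)) + ?g' x * exp (\<i> * z * of_real x)) (at x)"
      by (rule has_vector_derivative_mult)
    moreover have "g x * (\<i> * z * exp (\<i> * z * of_real x)) + ?g' x * exp (\<i> * z * of_real x) = k x"
      by (simp add: k_def mult_ac)
    ultimately show "((\<lambda>x. g x * exp (\<i> * z * of_real x)) has_vector_derivative k x) (at x within {-R..R})"
      by (simp add: has_vector_derivative_at_within)
  next
    show "continuous_on {-R..R} k" unfolding k_def
      by (intro continuous_intros test_funs_continuous_on assms g')
  qed (use R in auto)
  also have "\<dots> = 0" using r1 R by simp
  also have "(\<lambda>x. indicator {-R..R} x *\<^sub>R k x) = k"
  proof
    fix x
    show "indicator {-R..R} x *\<^sub>R k x = k x"
    proof (cases "R < \<bar>x\<bar>")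
      case True
      thus ?thesis using r1(2)[of x] r2(2)[of x] R by (simp add: k_def)
    qed (auto simp: indicator_def)
  qed
  also have "(LBINT x. k x) = fourier_laplace ?g' z + \<i> * z * fourier_laplace g z"
    unfolding k_def fourier_laplace_def
    by (subst Bochner_Integration.integral_add)
       (auto intro!: integrable_mult_right test_funs_mult_cont_integrable assms g' continuous_intros
             simp del: integrable_mult_right_iff)
  finally have "fourier_laplace ?g' z = - (\<i> * z * fourier_laplace g z)"
    by (simp add: eq_neg_iff_add_eq_0)
  hence "\<i> * fourier_laplace ?g' z = - (\<i> * \<i>) * (z * fourier_laplace g z)"
    by (simp add: mult_ac)
  thus ?thesis by simp
qed

lemma fourier_laplace_nderiv:
  assumes "g \<in> test_funs"
  shows "\<i> ^ n * fourier_laplace (nderiv n g) z = z ^ n * fourier_laplace g z"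
proof (induction n)
  case (Suc n)
  have "nderiv (Suc n) g = nderiv (Suc 0) (nderiv n g)" by (simp add: nderiv_Suc)
  hence "\<i> * fourier_laplace (nderiv (Suc n) g) z = z * fourier_laplace (nderiv n g) z"
    using fourier_laplace_nderiv_Suc[OF nderiv_test_funs[OF assms]] by simp
  hence "\<i> ^ Suc n * fourier_laplace (nderiv (Suc n) g) z = z * (\<i> ^ n * fourier_laplace (nderiv n g) z)"
    by (simp add: mult_ac)
  thus ?case by (simp add: Suc mult_ac)
qed simp

text \<open>Multiplication by z^n corresponds to n derivatives of \<open>g\<close>, which keep the
  support in [-r, r]; so the same exponential type r serves for every n.\<close>

lemma fourier_laplace_decay:
  assumes "g \<in> test_funs" and r: "\<And>x. r < \<bar>x\<bar> \<Longrightarrow> g x = 0"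
  obtains C where "C \<ge> 0"
    "\<And>z. (1 + norm z) ^ n * norm (fourier_laplace g z) \<le> C * exp (r * \<bar>Im z\<bar>)"
proof -
  have g': "nderiv n g \<in> test_funs" by (rule nderiv_test_funs[OF assms(1)])
  have r': "nderiv n g x = 0" if "r < \<bar>x\<bar>" for x
  proof -
    have "\<forall>x. r < \<bar>x\<bar> \<longrightarrow> nderiv n g x = 0"
    proof (induction n)
      case (Suc n)
      thus ?case using test_funs_vanishing_deriv[of r "nderiv n g"] by (simp add: nderiv_Suc)
    qed (use r in simp)
    with that show ?thesis by blast
  qed
  define A where "A = (LBINT \<xi>. norm (g \<xi>))"
  define B where "B = (LBINT \<xi>. norm (nderiv n g \<xi>))"
  have AB: "A \<ge> 0" "B \<ge> 0" by (auto simp: A_def B_def)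
  show ?thesis
  proof (rule that[of "2 ^ n * (A + B)"])
    fix z
    let ?L = "fourier_laplace g z"
    \<comment> \<open>Since 1 + |z| is at most 2 max(1, |z|), only the powers 0 and n of |z| have to
      be controlled.\<close>
    have "(1 + norm z) ^ n \<le> (2 * max 1 (norm z)) ^ n"
      by (intro power_mono) auto
    also have "\<dots> \<le> 2 ^ n * (1 + norm z ^ n)"
      by (auto simp: power_mult_distrib max_def)
    finally have "(1 + norm z) ^ n * norm ?L \<le> 2 ^ n * (1 + norm z ^ n) * norm ?L"
      by (intro mult_right_mono) auto
    also have "\<dots> = 2 ^ n * (norm ?L + norm (z ^ n * ?L))"
      by (simp add: norm_mult norm_power algebra_simps)
    also have "norm (z ^ n * ?L) = norm (fourier_laplace (nderiv n g) z)"
      unfolding fourier_laplace_nderiv[OF assms(1), symmetric]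
      by (simp add: norm_mult norm_power)
    also have "2 ^ n * (norm ?L + norm (fourier_laplace (nderiv n g) z)) \<le>
                 2 ^ n * (A * exp (r * \<bar>Im z\<bar>) + B * exp (r * \<bar>Im z\<bar>))"
      unfolding A_def B_def
      by (intro mult_left_mono add_mono norm_fourier_laplace_le assms g' r') auto
    finally show "(1 + norm z) ^ n * norm ?L \<le> 2 ^ n * (A + B) * exp (r * \<bar>Im z\<bar>)"
      by (simp add: algebra_simps)
  qed (use AB in auto)
qed

text \<open>Membership in Z comes first, because it makes \<open>fourier g\<close> integrable, and
  this is the hypothesis under which inversion applies to \<open>g\<close>.\<close>

theorem fourier_adj_test_funs:
  assumes g: "g \<in> test_funs"
  shows "fourier_adj g \<in> Z_space" and "fourier (fourier_adj g) = g"
proof -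
  define c where "c = 1 / sqrt (2 * pi)"
  have c: "c \<ge> 0" by (simp add: c_def)
  obtain r where r: "r > 0" "\<And>x. r < \<bar>x\<bar> \<Longrightarrow> g x = 0"
    using g by (auto simp: test_funs_iff)
  \<comment> \<open>Proved for every test function \<open>k\<close>: the n-th derivative of
    \<open>fourier_adj g\<close> is the transform of (i \<xi>)^n g(\<xi>), so the Schwartz estimates
    for derivatives are instances.\<close>
  have decay: "\<exists>C. \<forall>x. \<bar>x\<bar> ^ m * norm (fourier_adj k x) \<le> C" if k: "k \<in> test_funs" for m k
  proof -
    obtain R where "\<And>x. R < \<bar>x\<bar> \<Longrightarrow> k x = 0" using k unfolding test_funs_iff by blast
    then obtain C where C: "\<And>z. (1 + norm z) ^ m * norm (fourier_laplace k z) \<le> C * exp (R * \<bar>Im z\<bar>)"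
      using fourier_laplace_decay[OF k, of R m] by metis
    have "\<bar>x\<bar> ^ m * norm (fourier_adj k x) \<le> c * C" for x
    proof -
      have "\<bar>x\<bar> ^ m * norm (fourier_laplace k (of_real x)) \<le>
              (1 + \<bar>x\<bar>) ^ m * norm (fourier_laplace k (of_real x))"
        by (intro mult_right_mono power_mono) auto
      also have "\<dots> \<le> C" using C[of "of_real x"] by simp
      finally have "c * (\<bar>x\<bar> ^ m * norm (fourier_laplace k (of_real x))) \<le> c * C"
        using c by (intro mult_left_mono)
      moreover have "norm (fourier_adj k x) = c * norm (fourier_laplace k (of_real x))"
        using c unfolding fourier_adj_conv_laplace c_def[symmetric] norm_mult by simp
      ultimately show ?thesis by (simp add: mult_ac)
    qed
    thus ?thesis by blast
  qed
  have int: "integrable lborel (\<lambda>x. of_real x ^ n * g x)" for n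
    using test_funs_mult_cont_integrable[OF g, of "\<lambda>x. of_real x ^ n"]
    by (simp add: mult.commute continuous_intros)
  have "schwartz_fun (fourier_adj g)"
    unfolding schwartz_fun_def fourier_adj_smooth(2)[OF int]
    using fourier_adj_smooth(1)[OF int]
      decay[OF smooth_fun_mult_test_funs[OF smooth_fun_power g]] by blast
  moreover have "\<exists>C. \<forall>z. norm (of_real c * fourier_laplace g z) \<le>
                   C * inverse ((1 + norm z) ^ n) * exp (r * \<bar>Im z\<bar>)" for n
  proof -
    obtain C where C: "\<And>z. (1 + norm z) ^ n * norm (fourier_laplace g z) \<le> C * exp (r * \<bar>Im z\<bar>)"
      using fourier_laplace_decay[OF g, of r n] r(2) by metis
    have "norm (of_real c * fourier_laplace g z) \<le> (c * C) * inverse ((1 + norm z) ^ n) * exp (r * \<bar>Im z\<bar>)" for z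
    proof -
      have "(1 + norm z) ^ n > 0" by (intro zero_less_power add_pos_nonneg) auto
      hence "norm (fourier_laplace g z) \<le> (C * exp (r * \<bar>Im z\<bar>)) / (1 + norm z) ^ n"
        using C[of z] by (simp add: pos_le_divide_eq mult.commute)
      from mult_left_mono[OF this c] show ?thesis
        using c by (simp add: norm_mult divide_inverse mult_ac)
    qed
    thus ?thesis by blast
  qed
  moreover have "(\<lambda>z. of_real c * fourier_laplace g z) holomorphic_on UNIV"
    by (intro holomorphic_intros fourier_laplace_holomorphic g)
  moreover have "of_real c * fourier_laplace g (of_real x) = fourier_adj g x" for x
    by (simp only: fourier_adj_conv_laplace c_def)
  ultimately show Z: "fourier_adj g \<in> Z_space"
    unfolding Z_space_def using r(1) by blast
  have Fg: "fourier g = (\<lambda>\<xi>. fourier_adj g (- \<xi>))"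
    by (simp add: fourier_conv_adj fun_eq_iff)
  have "integrable lborel (fourier g)"
    unfolding Fg using lborel_integrable_real_affine[OF Z_space_integrable[OF Z, of 0], of "-1" 0] by simp
  moreover have "isCont g x" for x
    using test_funs_continuous_on[OF g, of UNIV] by (simp add: continuous_on_eq_continuous_at)
  moreover obtain M where "\<And>x. norm (g x) \<le> M" using test_funs_bounded[OF g] by blast
  ultimately have "fourier_adj (fourier g) x = g x" for x
    using fourier_inversion[OF test_funs_integrable[OF g]] by blast
  thus "fourier (fourier_adj g) = g"
    by (simp add: fun_eq_iff fourier_conv_adj_reflect Fg)
qed

section \<open>The complex Beta integral\<close>

text \<open>
  This is \<open>t\<close> to the power \<open>a - 1\<close>, cut off to the right half-line: with this shift the convolution of
  the functions for \<open>a\<close> and \<open>b\<close> is a multiple of the function for \<open>a + b\<close>.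
\<close>

definition tpow :: "complex \<Rightarrow> real \<Rightarrow> complex" where
  "tpow a t = (if t > 0 then exp ((a - 1) * of_real (ln t)) else 0)"

lemma tpow_nonpos [simp]: "t \<le> 0 \<Longrightarrow> tpow a t = 0"
  by (simp add: tpow_def)

lemma tpow_mult: "t > 0 \<Longrightarrow> tpow a (t * s) = tpow a t * tpow a s"
  by (simp add: tpow_def zero_less_mult_iff ln_mult algebra_simps flip: exp_add)

lemma cnj_tpow: "cnj (tpow a t) = tpow (cnj a) t"
  by (simp add: tpow_def exp_cnj)

lemma norm_tpow: "norm (tpow a t) = norm (tpow (of_real (Re a)) t)"
  by (simp add: tpow_def norm_exp_eq_Re)

lemma norm_tpow_powr: "t > 0 \<Longrightarrow> norm (tpow a t) = t powr (Re a - 1)"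
  by (simp add: tpow_def norm_exp_eq_Re powr_def)

lemma tpow_powr: "t > 0 \<Longrightarrow> tpow a t = of_real t powr (a - 1)"
  by (simp add: tpow_def powr_def Ln_of_real)

lemma borel_measurable_cnj [measurable]:
  assumes [measurable]: "f \<in> borel_measurable M"
  shows "(\<lambda>x. cnj (f x)) \<in> borel_measurable M"
proof -
  have [measurable]: "cnj \<in> borel_measurable borel"
    by (intro borel_measurable_continuous_onI continuous_intros)
  show ?thesis by measurable
qed

lemma borel_measurable_tpow [measurable]:
  assumes [measurable]: "a \<in> borel_measurable M" "f \<in> borel_measurable M"
  shows "(\<lambda>x. tpow (a x) (f x)) \<in> borel_measurable M"
proof -
  have [measurable]: "exp \<in> borel_measurable (borel :: complex measure)"
    by (intro borel_measurable_continuous_onI continuous_intros)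
  show ?thesis unfolding tpow_def by measurable
qed

text \<open>At t = 1 the modulus is the integrand of a real Beta integral; the substitution of t s
  for s reduces every other t > 0 to this case.\<close>

lemma tpow_conv_integrable:
  assumes "Re a > 0" "Re b > 0" "t > 0"
  shows "integrable lborel (\<lambda>s. tpow a s * tpow b (t - s))"
proof -
  have 1: "integrable lborel (\<lambda>s. tpow a s * tpow b (1 - s))"
  proof (rule Bochner_Integration.integrable_bound[OF integrable_Beta[OF assms(1,2), unfolded set_integrable_def]])
    show "AE s in lborel. norm (tpow a s * tpow b (1 - s)) \<le>
       norm (indicator {0..1} s *\<^sub>R (s powr (Re a - 1) * (1 - s) powr (Re b - 1)))"
    proof (rule AE_I2)
      fix s :: real
      show "norm (tpow a s * tpow b (1 - s)) \<le>
         norm (indicator {0..1} s *\<^sub>R (s powr (Re a - 1) * (1 - s) powr (Re b - 1)))"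
        by (cases "0 < s \<and> s < 1") (auto simp: norm_mult norm_tpow_powr abs_mult)
    qed
  qed measurable
  have "integrable lborel (\<lambda>s. tpow a (t * s) * tpow b (t - t * s))"
  proof -
    have "tpow a (t * s) * tpow b (t - t * s) = tpow a t * tpow b t * (tpow a s * tpow b (1 - s))" for s
      using tpow_mult[OF assms(3), of a s] tpow_mult[OF assms(3), of b "1 - s"]
      by (simp add: algebra_simps)
    thus ?thesis using integrable_mult_right[OF 1] by simp
  qed
  thus ?thesis
    using lborel_integrable_real_affine_iff[of t "\<lambda>s. tpow a s * tpow b (t - s)" 0] assms(3) by simp
qed

lemma integrable_pair_conv:
  fixes f g :: "real \<Rightarrow> complex"
  assumes f: "integrable lborel f" and g: "integrable lborel g"
  shows "integrable (lborel \<Otimes>\<^sub>M lborel) (\<lambda>(s, t). f s * g (t - s))"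
proof -
  have [measurable]: "f \<in> borel_measurable borel" "g \<in> borel_measurable borel"
    using borel_measurable_integrable[OF f] borel_measurable_integrable[OF g] by simp_all
  have shift: "integrable lborel (\<lambda>t. k (t - s))" if "integrable lborel k"
    for k :: "real \<Rightarrow> 'b :: {banach, second_countable_topology}" and s
    using lborel_integrable_real_affine[OF that, of 1 "-s"] by simp
  have "(LBINT t. norm (g (t - s))) = (LBINT t. norm (g t))" for s
    by (subst lborel_integral_real_affine[where c=1 and t="s"]) simp_all
  hence eq: "(LBINT t. norm (f s * g (t - s))) = norm (f s) * (LBINT t. norm (g t))" for s
    by (simp add: norm_mult)
  show ?thesis
  proof (rule lborel_pair.Fubini_integrable)
    show "integrable lborel (\<lambda>s. LBINT t. norm (case (s, t) of (s, t) \<Rightarrow> f s * g (t - s)))"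
      unfolding prod.case eq by (intro integrable_mult_left integrable_norm f)
    show "AE s in lborel. integrable lborel (\<lambda>t. case (s, t) of (s, t) \<Rightarrow> f s * g (t - s))"
      unfolding prod.case by (intro AE_I2 integrable_mult_right shift g)
  qed measurable
qed

lemma integral_conv:
  fixes f g :: "real \<Rightarrow> complex"
  assumes f: "integrable lborel f" and g: "integrable lborel g"
  shows "(LBINT t. LBINT s. f s * g (t - s)) = (LBINT s. f s) * (LBINT t. g t)"
proof -
  have "(LBINT t. LBINT s. f s * g (t - s)) = (LBINT s. LBINT t. f s * g (t - s))"
    by (rule lborel_pair.Fubini_integral[OF integrable_pair_conv[OF f g]])
  also have "\<dots> = (LBINT s. f s * (LBINT t. g t))"
  proof (intro Bochner_Integration.integral_cong refl)
    fix s
    have "(LBINT t. g (t - s)) = (LBINT t. g t)"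
      by (subst lborel_integral_real_affine[where c=1 and t="s"]) simp_all
    thus "(LBINT t. f s * g (t - s)) = f s * (LBINT t. g t)" by simp
  qed
  finally show ?thesis by simp
qed

text \<open>Euler's integral carried over to \<open>lborel\<close>: absolute integrability for the
  completed measure descends because the integrand is Borel measurable.\<close>

lemma has_bochner_integral_tpow_Gamma:
  assumes "Re a > 0"
  shows "integrable lborel (\<lambda>t. tpow a t * of_real (exp (- t)))"
    and "(LBINT t. tpow a t * of_real (exp (- t))) = Gamma a"
proof -
  let ?f = "\<lambda>t. complex_of_real t powr (a - 1) / of_real (exp t)"
  have eq: "(\<lambda>t. indicator {0<..} t *\<^sub>R ?f t) = (\<lambda>t. tpow a t * of_real (exp (- t)))"
    by (auto simp: fun_eq_iff indicator_def tpow_powr exp_minus divide_inverse)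
  have "integrable lebesgue (\<lambda>t. indicator {0<..} t *\<^sub>R ?f t)"
    using absolutely_integrable_Gamma_integral'[OF assms] by (simp add: set_integrable_def)
  hence int: "integrable lborel (\<lambda>t. tpow a t * of_real (exp (- t)))"
    unfolding eq by (subst (asm) integrable_completion) measurable
  thus "integrable lborel (\<lambda>t. tpow a t * of_real (exp (- t)))" .
  have "set_integrable lborel {0<..} ?f" using int unfolding set_integrable_def eq .
  from set_borel_integral_eq_integral(2)[OF this]
  have "(LBINT t. tpow a t * of_real (exp (- t))) = integral {0<..} ?f"
    unfolding set_lebesgue_integral_def eq .
  thus "(LBINT t. tpow a t * of_real (exp (- t))) = Gamma a"
    using Gamma_integral_complex'[OF assms] by (simp add: integral_unique)
qed

text \<open>Scaling shows that the convolution is B t^(a+b-1) for a constant B. Integrating against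
  e^(-t) gives Gamma a * Gamma b on one side, since e^(-t) = e^(-s) e^(-(t-s)) splits along the
  convolution, and B * Gamma (a + b) on the other.\<close>

theorem tpow_conv:
  assumes a: "Re a > 0" and b: "Re b > 0" and t: "t > 0"
  shows "(LBINT s. tpow a s * tpow b (t - s)) = tpow (a + b) t * (Gamma a * Gamma b / Gamma (a + b))"
proof -
  define B where "B = (LBINT s. tpow a s * tpow b (1 - s))"
  \<comment> \<open>Stated for all real t, as it is used under an integral over the whole line. For
    t > 0 the Jacobian t supplies the power missing between t^(a-1) t^(b-1) and t^(a+b-1).\<close>
  have scale: "(LBINT s. tpow a s * tpow b (t - s)) = B * tpow (a + b) t" for t
  proof (cases "t > 0")
    case True
    have "(LBINT s. tpow a s * tpow b (t - s)) = t *\<^sub>R (LBINT s. tpow a (t * s) * tpow b (t - t * s))"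
      using True by (subst lborel_integral_real_affine[where c=t and t=0]) simp_all
    also have "(\<lambda>s. tpow a (t * s) * tpow b (t - t * s)) =
       (\<lambda>s. tpow a t * tpow b t * (tpow a s * tpow b (1 - s)))"
    proof
      fix s
      show "tpow a (t * s) * tpow b (t - t * s) = tpow a t * tpow b t * (tpow a s * tpow b (1 - s))"
        using tpow_mult[OF True, of a s] tpow_mult[OF True, of b "1 - s"]
        by (simp add: algebra_simps)
    qed
    also have "(LBINT s. tpow a t * tpow b t * (tpow a s * tpow b (1 - s))) = tpow a t * tpow b t * B"
      unfolding B_def by (rule integral_mult_right_zero)
    also have "t *\<^sub>R (tpow a t * tpow b t * B) = B * tpow (a + b) t"
    proof -
      have "complex_of_real t = exp (of_real (ln t))" using True by (simp add: exp_of_real)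
      thus ?thesis using True
        by (simp add: tpow_def scaleR_conv_of_real algebra_simps flip: exp_add)
    qed
    finally show ?thesis .
  next
    case False
    hence "(\<lambda>s. tpow a s * tpow b (t - s)) = (\<lambda>s. 0)"
      by (auto simp: fun_eq_iff tpow_def)
    with False show ?thesis by simp
  qed
  have "Gamma a * Gamma b =
     (LBINT t. LBINT s. (tpow a s * of_real (exp (- s))) * (tpow b (t - s) * of_real (exp (- (t - s)))))"
    using integral_conv[OF has_bochner_integral_tpow_Gamma(1)[OF a] has_bochner_integral_tpow_Gamma(1)[OF b]]
    by (simp only: has_bochner_integral_tpow_Gamma(2)[OF a] has_bochner_integral_tpow_Gamma(2)[OF b])
  also have "\<dots> = (LBINT t. B * (tpow (a + b) t * of_real (exp (- t))))"
  proof (intro Bochner_Integration.integral_cong refl)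
    fix t
    have "(LBINT s. (tpow a s * of_real (exp (- s))) * (tpow b (t - s) * of_real (exp (- (t - s))))) =
          (LBINT s. of_real (exp (- t)) * (tpow a s * tpow b (t - s)))"
    proof (intro Bochner_Integration.integral_cong refl)
      fix s
      have "exp (- t) = exp (- s) * exp (- (t - s))" by (simp flip: exp_add)
      thus "(tpow a s * of_real (exp (- s))) * (tpow b (t - s) * of_real (exp (- (t - s)))) =
            of_real (exp (- t)) * (tpow a s * tpow b (t - s))"
        by (simp only: of_real_mult mult_ac)
    qed
    also have "\<dots> = of_real (exp (- t)) * (B * tpow (a + b) t)"
      by (simp only: integral_mult_right_zero scale)
    finally show "(LBINT s. (tpow a s * of_real (exp (- s))) * (tpow b (t - s) * of_real (exp (- (t - s))))) =
          B * (tpow (a + b) t * of_real (exp (- t)))" by (simp add: mult_ac)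
  qed
  also have "\<dots> = B * Gamma (a + b)"
    using has_bochner_integral_tpow_Gamma(2)[of "a + b"] a b by simp
  finally have "Gamma a * Gamma b = B * Gamma (a + b)" .
  moreover have "a + b \<notin> \<int>\<^sub>\<le>\<^sub>0"
    using a b by (auto elim!: nonpos_Ints_cases simp: complex_eq_iff)
  hence "Gamma (a + b) \<noteq> 0" by (simp add: Gamma_eq_zero_iff)
  ultimately show ?thesis by (simp add: scale field_simps)
qed

section \<open>The Laplace convolution in Mellin variables\<close>

text \<open>Kept as an integral of powers, rather than as t^(-1/2) times
  \<open>fourier_adj g (ln t)\<close>, so that the Laplace convolution can be taken under the
  integral sign. The cut-off in \<open>tpow\<close> yields the extension by zero used in
  \<open>D_space\<close>.\<close>

definition mellin_inv :: "(real \<Rightarrow> complex) \<Rightarrow> real \<Rightarrow> complex" where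
  "mellin_inv g t = of_real (1 / sqrt (2 * pi)) * (LBINT \<xi>. g \<xi> * tpow (1/2 + \<i> * of_real \<xi>) t)"

lemma mellin_inv_exp: "of_real (exp (x / 2)) * mellin_inv g (exp x) = fourier_adj g x"
proof -
  have "of_real (exp (x / 2)) * mellin_inv g (exp x) = of_real (1 / sqrt (2 * pi)) *
          (of_real (exp (x / 2)) * (LBINT \<xi>. g \<xi> * tpow (1/2 + \<i> * of_real \<xi>) (exp x)))"
    by (simp add: mellin_inv_def mult_ac)
  also have "of_real (exp (x / 2)) * (LBINT \<xi>. g \<xi> * tpow (1/2 + \<i> * of_real \<xi>) (exp x)) =
        (LBINT \<xi>. of_real (exp (x / 2)) * (g \<xi> * tpow (1/2 + \<i> * of_real \<xi>) (exp x)))"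
    by (rule integral_mult_right_zero[symmetric])
  also have "\<dots> = (LBINT \<xi>. g \<xi> * fkern x \<xi>)"
  proof (intro Bochner_Integration.integral_cong refl)
    fix \<xi>
    have "of_real (exp (x / 2)) * tpow (1/2 + \<i> * of_real \<xi>) (exp x) = fkern x \<xi>"
      by (simp add: tpow_def algebra_simps flip: exp_add exp_of_real)
    thus "of_real (exp (x / 2)) * (g \<xi> * tpow (1/2 + \<i> * of_real \<xi>) (exp x)) = g \<xi> * fkern x \<xi>"
      by (metis mult.left_commute)
  qed
  finally show ?thesis by (simp add: fourier_adj_def)
qed

lemma mellin_inv_nonpos: "t \<le> 0 \<Longrightarrow> mellin_inv g t = 0"
  by (simp add: mellin_inv_def)

lemma mellin_inv_D_space: "g \<in> test_funs \<Longrightarrow> mellin_inv g \<in> D_space"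
  unfolding D_space_def by (simp add: mellin_inv_exp mellin_inv_nonpos fourier_adj_test_funs)

lemma D_space_mellin_inv:
  assumes "f \<in> D_space"
  obtains g where "g \<in> test_funs" "f = mellin_inv g"
proof -
  define \<omega> where "\<omega> = (\<lambda>x. of_real (exp (x / 2)) * f (exp x))"
  have f: "f t = 0" if "t \<le> 0" for t
    using assms that by (auto simp: D_space_def)
  have \<omega>: "\<omega> \<in> Z_space"
    using assms by (auto simp: D_space_def \<omega>_def)
  have "f t = mellin_inv (fourier \<omega>) t" for t
  proof (cases "t > 0")
    case True
    have "of_real (exp (ln t / 2)) * mellin_inv (fourier \<omega>) (exp (ln t)) = \<omega> (ln t)"
      by (simp only: mellin_inv_exp fourier_Z_space(2)[OF \<omega>])
    also have "\<dots> = of_real (exp (ln t / 2)) * f (exp (ln t))" by (simp add: \<omega>_def)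
    finally show ?thesis using True by simp
  qed (simp add: f mellin_inv_nonpos)
  with that fourier_Z_space(1)[OF \<omega>] show ?thesis by blast
qed

lemma norm_tpow_half: "norm (tpow (1/2 + \<i> * of_real \<xi>) t) = norm (tpow (1/2) t)"
proof -
  have "Re (1/2 + \<i> * of_real \<xi>) = Re (1/2)" by simp
  thus ?thesis by (metis norm_tpow)
qed

text \<open>The modulus of t^(-1/2 + i \<xi>) is t^(-1/2) for every \<xi>; the resulting bound is
  the majorant for the exchanges of integrals in the convolution formula.\<close>

lemma norm_mellin_inv_le:
  assumes "integrable lborel g"
  obtains M where "M \<ge> 0" "\<And>t. norm (mellin_inv g t) \<le> M * norm (tpow (1/2) t)"
proof (rule that[of "1 / sqrt (2 * pi) * (LBINT \<xi>. norm (g \<xi>))"])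
  fix t
  have "norm (LBINT \<xi>. g \<xi> * tpow (1/2 + \<i> * of_real \<xi>) t) \<le>
          (LBINT \<xi>. norm (g \<xi> * tpow (1/2 + \<i> * of_real \<xi>) t))"
    by (rule integral_norm_bound)
  also have "\<dots> = (LBINT \<xi>. norm (g \<xi>)) * norm (tpow (1/2) t)"
    by (simp add: norm_mult norm_tpow_half)
  finally show "norm (mellin_inv g t) \<le> 1 / sqrt (2 * pi) * (LBINT \<xi>. norm (g \<xi>)) * norm (tpow (1/2) t)"
    by (simp add: mellin_inv_def norm_mult norm_divide divide_right_mono)
qed simp

lemma Gamma_Re_pos_neq_0: "Re z > 0 \<Longrightarrow> Gamma z \<noteq> 0"
  by (auto simp: Gamma_eq_zero_iff elim!: nonpos_Ints_cases)

lemma smooth_fun_Gamma_line: "smooth_fun (\<lambda>\<xi>. Gamma (1/2 + \<i> * of_real \<xi>))"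
proof (rule smooth_fun_holomorphic_vertical_line)
  show "Gamma holomorphic_on {z. Re z > 0}"
    by (intro holomorphic_Gamma) (auto elim!: nonpos_Ints_cases)
  show "open {z. Re z > 0}" by (intro open_Collect_less continuous_intros)
qed simp

lemma smooth_fun_inverse_Gamma_line: "smooth_fun (\<lambda>\<xi>. inverse (Gamma (1/2 + \<i> * of_real \<xi>)))"
  unfolding rGamma_inverse_Gamma[symmetric]
  by (rule smooth_fun_holomorphic_vertical_line[OF holomorphic_rGamma open_UNIV]) (rule UNIV_I)

text \<open>The two factors are expanded one after the other, each expansion followed by an
  exchange, until the s-integral is innermost and \<open>tpow_conv\<close> evaluates it. The result
  depends on the frequencies jointly only through \<xi> - \<eta>, which becomes the new variable
  \<zeta>.\<close>

lemma laplace_conv_mellin_inv: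
  assumes g: "g \<in> test_funs" and t: "t > 0"
  defines "G \<equiv> \<lambda>\<xi>. Gamma (1/2 + \<i> * of_real \<xi>) * g \<xi>"
  shows "laplace_conv (\<lambda>t. cnj (mellin_inv g t)) (mellin_inv g) t =
    of_real (1 / sqrt (2 * pi)) * fourier_adj (\<lambda>\<zeta>. inverse (Gamma (1 + \<i> * of_real \<zeta>)) *
      convol (reflect (\<lambda>\<xi>. cnj (G \<xi>))) G \<zeta>) (ln t)"
proof -
  define c where "c = complex_of_real (1 / sqrt (2 * pi))"
  have [simp]: "cnj c = c" by (simp add: c_def)
  let ?f = "mellin_inv g"
  let ?p = "\<lambda>\<xi>. tpow (1/2 + \<i> * of_real \<xi>)" and ?q = "\<lambda>\<xi>. tpow (1/2 - \<i> * of_real \<xi>)"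
  define K where "K = (\<lambda>\<zeta>. inverse (Gamma (1 + \<i> * of_real \<zeta>)) * fkern (ln t) \<zeta>)"
  have gint: "integrable lborel g" by (rule test_funs_integrable[OF g])
  have cgint: "integrable lborel (\<lambda>\<eta>. cnj (g \<eta>))" using gint by simp
  have [measurable]: "g \<in> borel_measurable borel"
    using borel_measurable_integrable[OF gint] by simp
  have fm [measurable]: "?f \<in> borel_measurable borel"
    unfolding mellin_inv_def by measurable
  have G: "G \<in> test_funs"
    unfolding G_def by (rule smooth_fun_mult_test_funs[OF smooth_fun_Gamma_line g])
  have Gint: "integrable lborel G" by (rule test_funs_integrable[OF G])
  have [measurable]: "G \<in> borel_measurable borel"
    using borel_measurable_integrable[OF Gint] by simp
  obtain M where M: "M \<ge> 0" "\<And>t. norm (?f t) \<le> M * norm (tpow (1/2) t)"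
    using norm_mellin_inv_le[OF gint] by blast
  have pp: "integrable lborel (\<lambda>s. tpow (1/2) s * tpow (1/2) (t - s))"
    by (rule tpow_conv_integrable) (use t in auto)
  have nq: "norm (?q \<eta> s) = norm (tpow (1/2) s)" for \<eta> s
    using norm_tpow_half[of "- \<eta>" s] by simp

  \<comment> \<open>The range [0, t] may be widened to the line: outside it one of the arguments s
    and t - s is negative, and \<open>mellin_inv g\<close> vanishes there.\<close>
  have "laplace_conv (\<lambda>t. cnj (?f t)) ?f t = (LBINT s. cnj (?f s) * ?f (t - s))"
    unfolding laplace_conv_def set_lebesgue_integral_def
    by (intro Bochner_Integration.integral_cong refl)
       (auto simp: indicator_def mellin_inv_nonpos)
  \<comment> \<open>Only the second factor is opened; the conjugate factor stays whole and is
    estimated by \<open>M\<close>, so that the exchange involves just two variables.\<close>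
  also have "\<dots> = (LBINT s. LBINT \<xi>. c * (cnj (?f s) * ?p \<xi> (t - s) * g \<xi>))"
  proof (intro Bochner_Integration.integral_cong refl)
    fix s
    have "cnj (?f s) * ?f (t - s) = c * (cnj (?f s) * (LBINT \<xi>. g \<xi> * ?p \<xi> (t - s)))"
      by (simp add: mellin_inv_def[of g "t - s"] c_def)
    also have "\<dots> = (LBINT \<xi>. c * (cnj (?f s) * (g \<xi> * ?p \<xi> (t - s))))"
      by (simp only: integral_mult_right_zero)
    finally show "cnj (?f s) * ?f (t - s) = (LBINT \<xi>. c * (cnj (?f s) * ?p \<xi> (t - s) * g \<xi>))"
      by (simp add: mult_ac)
  qed
  also have "\<dots> = (LBINT \<xi>. LBINT s. c * (cnj (?f s) * ?p \<xi> (t - s) * g \<xi>))"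
  proof (rule lborel_pair.Fubini_integral[symmetric], rule integrable_pair_bound[OF _ gint])
    show "integrable lborel (\<lambda>s. (c * of_real M) * (tpow (1/2) s * tpow (1/2) (t - s)))"
      by (intro integrable_mult_right pp)
    show "norm (c * (cnj (?f s) * ?p \<xi> (t - s) * g \<xi>)) \<le>
            norm ((c * of_real M) * (tpow (1/2) s * tpow (1/2) (t - s))) * norm (g \<xi>)" for s \<xi>
    proof -
      have "norm c * (norm (?f s) * norm (tpow (1/2) (t - s)) * norm (g \<xi>)) \<le>
              norm c * (M * norm (tpow (1/2) s) * norm (tpow (1/2) (t - s)) * norm (g \<xi>))"
        by (intro mult_left_mono mult_right_mono M) auto
      thus ?thesis using M(1) by (simp add: norm_mult norm_tpow_half mult_ac)
    qed
  qed measurable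
  also have "\<dots> = (LBINT \<xi>. c\<^sup>2 * (G \<xi> * (LBINT \<eta>. cnj (G \<eta>) * K (\<xi> - \<eta>))))"
  proof (intro Bochner_Integration.integral_cong refl)
    fix \<xi>
    have "(LBINT s. c * (cnj (?f s) * ?p \<xi> (t - s) * g \<xi>)) =
            (LBINT s. LBINT \<eta>. c\<^sup>2 * (g \<xi> * (cnj (g \<eta>) * (?q \<eta> s * ?p \<xi> (t - s)))))"
    proof (intro Bochner_Integration.integral_cong refl)
      fix s
      have "cnj (?f s) = c * (LBINT \<eta>. cnj (g \<eta>) * ?q \<eta> s)"
      proof -
        have "(LBINT \<eta>. cnj (g \<eta>) * ?q \<eta> s) = (LBINT \<eta>. cnj (g \<eta> * ?p \<eta> s))"
          by (intro Bochner_Integration.integral_cong refl) (simp add: cnj_tpow)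
        thus ?thesis
          unfolding Bochner_Integration.integral_cnj mellin_inv_def c_def[symmetric] by simp
      qed
      hence "c * (cnj (?f s) * ?p \<xi> (t - s) * g \<xi>) =
               (c\<^sup>2 * (g \<xi> * ?p \<xi> (t - s))) * (LBINT \<eta>. cnj (g \<eta>) * ?q \<eta> s)"
        by (simp add: power2_eq_square mult_ac)
      also have "\<dots> = (LBINT \<eta>. (c\<^sup>2 * (g \<xi> * ?p \<xi> (t - s))) * (cnj (g \<eta>) * ?q \<eta> s))"
        by (rule integral_mult_right_zero[symmetric])
      finally show "c * (cnj (?f s) * ?p \<xi> (t - s) * g \<xi>) =
          (LBINT \<eta>. c\<^sup>2 * (g \<xi> * (cnj (g \<eta>) * (?q \<eta> s * ?p \<xi> (t - s)))))"
        by (simp add: mult_ac)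
    qed
    also have "\<dots> = (LBINT \<eta>. LBINT s. c\<^sup>2 * (g \<xi> * (cnj (g \<eta>) * (?q \<eta> s * ?p \<xi> (t - s)))))"
    proof (rule lborel_pair.Fubini_integral[symmetric], rule integrable_pair_bound[OF _ cgint])
      show "integrable lborel (\<lambda>s. (c\<^sup>2 * g \<xi>) * (tpow (1/2) s * tpow (1/2) (t - s)))"
        by (intro integrable_mult_right pp)
      show "norm (c\<^sup>2 * (g \<xi> * (cnj (g \<eta>) * (?q \<eta> s * ?p \<xi> (t - s))))) \<le>
          norm ((c\<^sup>2 * g \<xi>) * (tpow (1/2) s * tpow (1/2) (t - s))) * norm (cnj (g \<eta>))" for s \<eta>
        by (simp add: norm_mult nq norm_tpow_half mult_ac)
    qed measurable
    also have "\<dots> = (LBINT \<eta>. c\<^sup>2 * (G \<xi> * (cnj (G \<eta>) * K (\<xi> - \<eta>))))"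
    proof (intro Bochner_Integration.integral_cong refl)
      fix \<eta>
      have "(LBINT s. ?q \<eta> s * ?p \<xi> (t - s)) =
              tpow ((1/2 - \<i> * of_real \<eta>) + (1/2 + \<i> * of_real \<xi>)) t *
              (Gamma (1/2 - \<i> * of_real \<eta>) * Gamma (1/2 + \<i> * of_real \<xi>) /
               Gamma ((1/2 - \<i> * of_real \<eta>) + (1/2 + \<i> * of_real \<xi>)))"
        by (rule tpow_conv) (use t in auto)
      also have "(1/2 - \<i> * of_real \<eta>) + (1/2 + \<i> * of_real \<xi>) = 1 + \<i> * of_real (\<xi> - \<eta>)"
        by (simp add: algebra_simps)
      also have "tpow (1 + \<i> * of_real (\<xi> - \<eta>)) t = fkern (ln t) (\<xi> - \<eta>)"
        using t by (simp add: tpow_def mult_ac)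
      also have "Gamma (1/2 - \<i> * of_real \<eta>) = cnj (Gamma (1/2 + \<i> * of_real \<eta>))"
        by (simp add: cnj_Gamma)
      finally have "(LBINT s. ?q \<eta> s * ?p \<xi> (t - s)) =
          K (\<xi> - \<eta>) * (cnj (Gamma (1/2 + \<i> * of_real \<eta>)) * Gamma (1/2 + \<i> * of_real \<xi>))"
        unfolding K_def divide_inverse by (simp only: mult_ac)
      hence "(LBINT s. c\<^sup>2 * (g \<xi> * (cnj (g \<eta>) * (?q \<eta> s * ?p \<xi> (t - s))))) =
          c\<^sup>2 * (g \<xi> * (cnj (g \<eta>) * (K (\<xi> - \<eta>) *
            (cnj (Gamma (1/2 + \<i> * of_real \<eta>)) * Gamma (1/2 + \<i> * of_real \<xi>)))))"
        by (simp only: integral_mult_right_zero)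
      thus "(LBINT s. c\<^sup>2 * (g \<xi> * (cnj (g \<eta>) * (?q \<eta> s * ?p \<xi> (t - s))))) =
          c\<^sup>2 * (G \<xi> * (cnj (G \<eta>) * K (\<xi> - \<eta>)))"
        by (simp only: G_def complex_cnj_mult mult_ac)
    qed
    also have "\<dots> = c\<^sup>2 * (G \<xi> * (LBINT \<eta>. cnj (G \<eta>) * K (\<xi> - \<eta>)))"
      by (simp only: integral_mult_right_zero)
    finally show "(LBINT s. c * (cnj (?f s) * ?p \<xi> (t - s) * g \<xi>)) =
        c\<^sup>2 * (G \<xi> * (LBINT \<eta>. cnj (G \<eta>) * K (\<xi> - \<eta>)))" .
  qed
  also have "\<dots> = (LBINT \<xi>. LBINT \<zeta>. c\<^sup>2 * (G \<xi> * (cnj (G (\<xi> - \<zeta>)) * K \<zeta>)))"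
  proof (intro Bochner_Integration.integral_cong refl)
    fix \<xi>
    have "(LBINT \<eta>. cnj (G \<eta>) * K (\<xi> - \<eta>)) = (LBINT \<zeta>. cnj (G (\<xi> - \<zeta>)) * K \<zeta>)"
      by (subst lborel_integral_real_affine[where c="-1" and t=\<xi>]) simp_all
    thus "c\<^sup>2 * (G \<xi> * (LBINT \<eta>. cnj (G \<eta>) * K (\<xi> - \<eta>))) =
            (LBINT \<zeta>. c\<^sup>2 * (G \<xi> * (cnj (G (\<xi> - \<zeta>)) * K \<zeta>)))"
      by (simp only: integral_mult_right_zero)
  qed
  \<comment> \<open>\<open>K\<close> is unbounded, so there is no global majorant. But G(\<xi>) and
    G(\<xi> - \<zeta>) are both nonzero only if |\<zeta>| <= 2 r, and on that interval continuity
    bounds \<open>K\<close>; the indicator \<open>B\<close> records the restriction.\<close>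
  also have "\<dots> = (LBINT \<zeta>. LBINT \<xi>. c\<^sup>2 * (G \<xi> * (cnj (G (\<xi> - \<zeta>)) * K \<zeta>)))"
  proof -
    obtain r where r: "r > 0" "\<And>x. r < \<bar>x\<bar> \<Longrightarrow> G x = 0"
      using G unfolding test_funs_iff by blast
    obtain M1 where M1: "\<And>x. norm (G x) \<le> M1" using test_funs_bounded[OF G] by blast
    have K_cont: "continuous_on UNIV K"
    proof -
      have "K = (\<lambda>\<zeta>. rGamma (1 + \<i> * of_real \<zeta>) * fkern (ln t) \<zeta>)"
        by (simp add: K_def rGamma_inverse_Gamma)
      moreover have "continuous_on UNIV (\<lambda>\<zeta>::real. rGamma (1 + \<i> * of_real \<zeta>) :: complex)"
        by (rule continuous_on_compose2[OF holomorphic_on_imp_continuous_on[OF holomorphic_rGamma[of UNIV]]])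
           (auto intro!: continuous_intros)
      ultimately show ?thesis by (auto intro!: continuous_intros)
    qed
    hence [measurable]: "K \<in> borel_measurable borel"
      by (rule borel_measurable_continuous_onI)
    have "compact (K ` {-2*r..2*r})"
      by (rule compact_continuous_image[OF continuous_on_subset[OF K_cont]]) auto
    then obtain M2 where M2: "M2 > 0" "\<And>x. x \<in> {-2*r..2*r} \<Longrightarrow> norm (K x) \<le> M2"
      using compact_imp_bounded by (force simp: bounded_pos)
    define B where "B = (\<lambda>\<zeta>. complex_of_real (indicator {-2*r..2*r} \<zeta>))"
    have Bint: "integrable lborel B"
      unfolding B_def by (subst complex_of_real_integrable_eq, rule integrable_real_indicator)
        (auto simp: emeasure_lborel_Icc_eq)
    have "norm (c\<^sup>2 * (G \<xi> * (cnj (G (\<xi> - \<zeta>)) * K \<zeta>))) \<le>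
            norm ((c\<^sup>2 * of_real (M1 * M2)) * G \<xi>) * norm (B \<zeta>)" for \<xi> \<zeta>
    proof (cases "\<bar>\<xi>\<bar> \<le> r \<and> \<bar>\<xi> - \<zeta>\<bar> \<le> r")
      case True
      hence "- 2 * r \<le> \<zeta>" "\<zeta> \<le> 2 * r" by linarith+
      hence \<zeta>: "\<zeta> \<in> {-2*r..2*r}" by (simp only: atLeastAtMost_iff)
      have M1_nonneg: "M1 \<ge> 0" by (rule order_trans[OF norm_ge_zero M1[of 0]])
      have "norm (c\<^sup>2) * (norm (G \<xi>) * (norm (G (\<xi> - \<zeta>)) * norm (K \<zeta>))) \<le>
              norm (c\<^sup>2) * (norm (G \<xi>) * (M1 * M2))"
        using M1_nonneg by (intro mult_left_mono mult_mono M1 M2 \<zeta>) auto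
      thus ?thesis using \<zeta> M1_nonneg M2(1) by (simp add: B_def norm_mult mult_ac)
    next
      case False
      hence "G \<xi> = 0 \<or> G (\<xi> - \<zeta>) = 0" using r(2) by (meson not_le)
      thus ?thesis by auto
    qed
    thus ?thesis
      by (intro lborel_pair.Fubini_integral[symmetric]
            integrable_pair_bound[OF integrable_mult_right[OF Gint] Bint]) measurable
  qed
  also have "\<dots> = (LBINT \<zeta>. c\<^sup>2 * (K \<zeta> * convol (reflect (\<lambda>\<xi>. cnj (G \<xi>))) G \<zeta>))"
  proof (intro Bochner_Integration.integral_cong refl)
    fix \<zeta>
    have "(LBINT \<xi>. c\<^sup>2 * (G \<xi> * (cnj (G (\<xi> - \<zeta>)) * K \<zeta>))) =
            (LBINT \<xi>. c\<^sup>2 * (K \<zeta> * (cnj (G (\<xi> - \<zeta>)) * G \<xi>)))"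
      by (simp add: mult_ac)
    thus "(LBINT \<xi>. c\<^sup>2 * (G \<xi> * (cnj (G (\<xi> - \<zeta>)) * K \<zeta>))) =
            c\<^sup>2 * (K \<zeta> * convol (reflect (\<lambda>\<xi>. cnj (G \<xi>))) G \<zeta>)"
      by (simp only: integral_mult_right_zero convol_def reflect_def minus_diff_eq)
  qed
  also have "\<dots> = c * (c * (LBINT \<zeta>. inverse (Gamma (1 + \<i> * of_real \<zeta>)) *
      convol (reflect (\<lambda>\<xi>. cnj (G \<xi>))) G \<zeta> * fkern (ln t) \<zeta>))"
    unfolding power2_eq_square mult.assoc integral_mult_right_zero K_def by (simp only: mult_ac)
  finally show ?thesis by (simp only: fourier_adj_def c_def)
qed

text \<open>Only the conjugate factor of |u|^2 is written as a Fourier integral over \<eta>; after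
  the exchange, the x-integral is the transform of \<open>u\<close> at \<xi> + \<eta>, and a
  translation of \<eta> gives the convolution.\<close>

lemma fourier_norm_square:
  assumes u: "u \<in> Z_space"
  shows "fourier (\<lambda>x. of_real ((norm (u x))\<^sup>2)) \<xi> =
    of_real (1 / sqrt (2 * pi)) * convol (reflect (\<lambda>\<xi>. cnj (fourier u \<xi>))) (fourier u) \<xi>"
proof -
  define c where "c = complex_of_real (1 / sqrt (2 * pi))"
  have [simp]: "cnj c = c" by (simp add: c_def)
  define g where "g = fourier u"
  have g: "g \<in> test_funs" "fourier_adj g = u"
    using fourier_Z_space[OF u] by (simp_all add: g_def)
  have uint: "integrable lborel u" using Z_space_integrable[OF u, of 0] by simp
  have cgint: "integrable lborel (\<lambda>\<eta>. cnj (g \<eta>))" using test_funs_integrable[OF g(1)] by simp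
  have [measurable]: "u \<in> borel_measurable borel" "(\<lambda>\<eta>. cnj (g \<eta>)) \<in> borel_measurable borel"
    using borel_measurable_integrable[OF uint] borel_measurable_integrable[OF cgint] by simp_all
  have "(LBINT x. of_real ((norm (u x))\<^sup>2) * exp (- (\<i> * of_real x * of_real \<xi>))) =
        (LBINT x. LBINT \<eta>. c * (u x * fkern (- x) (\<xi> + \<eta>) * cnj (g \<eta>)))"
  proof (intro Bochner_Integration.integral_cong refl)
    fix x
    have "cnj (u x) = c * (LBINT \<eta>. cnj (g \<eta> * fkern x \<eta>))"
      unfolding Bochner_Integration.integral_cnj c_def g(2)[symmetric] fourier_adj_def by simp
    moreover have "complex_of_real ((norm (u x))\<^sup>2) = u x * cnj (u x)"
      by (rule complex_norm_square)
    ultimately have "of_real ((norm (u x))\<^sup>2) * exp (- (\<i> * of_real x * of_real \<xi>)) =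
        (c * (u x * fkern (- x) \<xi>)) * (LBINT \<eta>. cnj (g \<eta> * fkern x \<eta>))"
      by (simp add: mult_ac)
    also have "\<dots> = (LBINT \<eta>. (c * (u x * fkern (- x) \<xi>)) * cnj (g \<eta> * fkern x \<eta>))"
      by (rule integral_mult_right_zero[symmetric])
    also have "\<dots> = (LBINT \<eta>. c * (u x * fkern (- x) (\<xi> + \<eta>) * cnj (g \<eta>)))"
    proof (intro Bochner_Integration.integral_cong refl)
      fix \<eta>
      have "fkern (- x) (\<xi> + \<eta>) = fkern (- x) \<xi> * cnj (fkern x \<eta>)"
        by (simp add: exp_cnj algebra_simps flip: exp_add)
      thus "(c * (u x * fkern (- x) \<xi>)) * cnj (g \<eta> * fkern x \<eta>) =
          c * (u x * fkern (- x) (\<xi> + \<eta>) * cnj (g \<eta>))"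
        by (simp only: complex_cnj_mult mult_ac)
    qed
    finally show "of_real ((norm (u x))\<^sup>2) * exp (- (\<i> * of_real x * of_real \<xi>)) =
        (LBINT \<eta>. c * (u x * fkern (- x) (\<xi> + \<eta>) * cnj (g \<eta>)))" .
  qed
  also have "\<dots> = (LBINT \<eta>. LBINT x. c * (u x * fkern (- x) (\<xi> + \<eta>) * cnj (g \<eta>)))"
  proof (rule lborel_pair.Fubini_integral[symmetric], rule integrable_pair_bound[OF _ cgint])
    show "integrable lborel (\<lambda>x. c * u x)" by (intro integrable_mult_right uint)
    show "norm (c * (u x * fkern (- x) (\<xi> + \<eta>) * cnj (g \<eta>))) \<le> norm (c * u x) * norm (cnj (g \<eta>))" for x \<eta>
      by (simp only: norm_mult norm_fkern complex_mod_cnj mult_1_right order_refl)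
  qed measurable
  also have "\<dots> = (LBINT \<eta>. cnj (g \<eta>) * g (\<xi> + \<eta>))"
  proof (intro Bochner_Integration.integral_cong refl)
    fix \<eta>
    have "(LBINT x. c * (u x * fkern (- x) (\<xi> + \<eta>) * cnj (g \<eta>))) =
          (LBINT x. cnj (g \<eta>) * (c * (u x * exp (- (\<i> * of_real x * of_real (\<xi> + \<eta>))))))"
      by (simp add: mult_ac)
    thus "(LBINT x. c * (u x * fkern (- x) (\<xi> + \<eta>) * cnj (g \<eta>))) = cnj (g \<eta>) * g (\<xi> + \<eta>)"
      by (simp only: integral_mult_right_zero g_def fourier_def c_def)
  qed
  also have "\<dots> = (LBINT \<eta>. cnj (g (\<eta> - \<xi>)) * g \<eta>)"
    by (subst lborel_integral_real_affine[where c=1 and t="- \<xi>"]) (simp_all add: algebra_simps)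
  also have "\<dots> = convol (reflect (\<lambda>\<xi>. cnj (g \<xi>))) g \<xi>"
    by (simp add: convol_def reflect_def)
  finally show ?thesis by (simp only: fourier_def g_def)
qed

section \<open>The three positivity conditions\<close>

text \<open>A real factor enters this sesquilinear expression squared, so a constant sqrt(2 pi) is
  absorbed by scaling the function with a fourth root.\<close>

lemma convol_reflect_cnj_scale:
  "convol (reflect (\<lambda>\<xi>. cnj (of_real k * G \<xi>))) (\<lambda>\<xi>. of_real k * G \<xi>) \<zeta> =
     of_real (k\<^sup>2) * convol (reflect (\<lambda>\<xi>. cnj (G \<xi>))) G \<zeta>"
proof -
  have "convol (reflect (\<lambda>\<xi>. cnj (of_real k * G \<xi>))) (\<lambda>\<xi>. of_real k * G \<xi>) \<zeta> =
     (LBINT \<eta>. of_real (k\<^sup>2) * (reflect (\<lambda>\<xi>. cnj (G \<xi>)) (\<zeta> - \<eta>) * G \<eta>))"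
    unfolding convol_def
    by (intro Bochner_Integration.integral_cong refl) (simp add: reflect_def power2_eq_square)
  thus ?thesis by (simp only: integral_mult_right_zero convol_def)
qed

lemma fourier_adj_scale: "fourier_adj (\<lambda>x. k * u x) t = k * fourier_adj u t"
proof -
  have "(LBINT x. k * u x * fkern t x) = (LBINT x. k * (u x * fkern t x))" by (simp add: mult_ac)
  thus ?thesis by (simp only: fourier_adj_def integral_mult_right_zero mult.left_commute)
qed

text \<open>\<open>theta_fun\<close> passes to \<open>h\<close> a function extended by zero, so the
  Laplace convolution has to agree with it on t <= 0 as well. At t = 0 the domain of integration is
  one point, hence a null set.\<close>

lemma laplace_conv_nonpos:
  assumes "t \<le> 0"
  shows "laplace_conv f g t = 0"
proof -
  \<comment> \<open>The interval is empty or equal to {0}; in the second case s = 0, so the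
    integrand may be replaced by a constant without any measurability of \<open>f\<close> and
    \<open>g\<close>.\<close>
  have "(\<lambda>s. indicator {0..t} s *\<^sub>R (f s * g (t - s))) =
        (\<lambda>s. indicator {0..t} s *\<^sub>R (f 0 * g t))"
  proof
    fix s
    show "indicator {0..t} s *\<^sub>R (f s * g (t - s)) = indicator {0..t} s *\<^sub>R (f 0 * g t)"
      using assms by (cases "s = 0") (auto simp: indicator_def)
  qed
  moreover have "(LBINT s. indicator {0..t} s *\<^sub>R (f 0 * g t)) =
                   (LBINT s. indicator {0..t} s) *\<^sub>R (f 0 * g t)"
    by (rule integral_scaleR_left, rule integrable_real_indicator)
       (auto simp: emeasure_lborel_Icc_eq)
  moreover have "(LBINT s. indicator {0..t} s) = (0 :: real)"
    using assms by (cases "t = 0") auto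
  ultimately show ?thesis
    by (simp only: laplace_conv_def set_lebesgue_integral_def scale_zero_left)
qed

text \<open>
  With the fourth root of \<open>2 * pi\<close> as a factor in \<open>f\<close>, the function to which \<open>b_fun h\<close> applies \<open>h\<close>
  is literally a Laplace convolution, so that no homogeneity of \<open>h\<close> enters.
\<close>

lemma b_fun_convol:
  assumes G: "G \<in> test_funs"
  defines "f \<equiv> mellin_inv (\<lambda>\<xi>. of_real (sqrt (sqrt (2 * pi))) *
                 (inverse (Gamma (1/2 + \<i> * of_real \<xi>)) * G \<xi>))"
  shows "b_fun h (convol (reflect (\<lambda>\<xi>. cnj (G \<xi>))) G) =
           of_real (1 / sqrt (2 * pi)) * h (laplace_conv (\<lambda>t. cnj (f t)) f)"
proof -
  define k where "k = sqrt (sqrt (2 * pi))"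
  define g where "g = (\<lambda>\<xi>. of_real k * (inverse (Gamma (1/2 + \<i> * of_real \<xi>)) * G \<xi>))"
  have k2: "k\<^sup>2 = sqrt (2 * pi)" by (simp add: k_def)
  have g: "g \<in> test_funs" unfolding g_def
    by (intro smooth_fun_mult_test_funs smooth_fun_const smooth_fun_inverse_Gamma_line G)
  have Gg: "Gamma (1/2 + \<i> * of_real \<xi>) * g \<xi> = of_real k * G \<xi>" for \<xi>
    using Gamma_Re_pos_neq_0[of "1/2 + \<i> * of_real \<xi>"] by (simp add: g_def)
  let ?C = "convol (reflect (\<lambda>\<xi>. cnj (G \<xi>))) G"
  have f: "f = mellin_inv g" by (simp only: f_def g_def k_def)
  have "(\<lambda>t. if t > 0 then fourier_adj (\<lambda>\<xi>. inverse (Gamma (1 + \<i> * of_real \<xi>)) * ?C \<xi>) (ln t) else 0) =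
          laplace_conv (\<lambda>t. cnj (f t)) f"
  proof
    fix t :: real
    show "(if t > 0 then fourier_adj (\<lambda>\<xi>. inverse (Gamma (1 + \<i> * of_real \<xi>)) * ?C \<xi>) (ln t) else 0) =
            laplace_conv (\<lambda>t. cnj (f t)) f t"
    proof (cases "t > 0")
      case True
      have "laplace_conv (\<lambda>t. cnj (f t)) f t =
        of_real (1 / sqrt (2 * pi)) * fourier_adj (\<lambda>\<zeta>. inverse (Gamma (1 + \<i> * of_real \<zeta>)) *
          (of_real (k\<^sup>2) * ?C \<zeta>)) (ln t)"
        unfolding f laplace_conv_mellin_inv[OF g True] Gg convol_reflect_cnj_scale ..
      also have "\<dots> = of_real (1 / sqrt (2 * pi)) * (of_real (k\<^sup>2) *
          fourier_adj (\<lambda>\<zeta>. inverse (Gamma (1 + \<i> * of_real \<zeta>)) * ?C \<zeta>) (ln t))"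
        by (simp only: fourier_adj_scale[symmetric] mult.left_commute)
      also have "\<dots> = fourier_adj (\<lambda>\<zeta>. inverse (Gamma (1 + \<i> * of_real \<zeta>)) * ?C \<zeta>) (ln t)"
        unfolding k2 by simp
      finally show ?thesis using True by simp
    qed (simp add: laplace_conv_nonpos)
  qed
  thus ?thesis by (simp only: b_fun_def a_fun_def theta_fun_def)
qed

text \<open>The factor (2 pi)^(-1/4) in \<open>G\<close> absorbs the (2 pi)^(-1/2) of
  \<open>fourier_norm_square\<close>; the remaining sqrt(2 pi) is the one in
  \<open>sign_fun\<close>.\<close>

lemma sign_fun_norm_square:
  assumes u: "u \<in> Z_space"
  defines "G \<equiv> \<lambda>\<xi>. of_real (1 / sqrt (sqrt (2 * pi))) * fourier u \<xi>"
  shows "sign_fun h (\<lambda>x. of_real ((norm (u x))\<^sup>2)) =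
           of_real (sqrt (2 * pi)) * b_fun h (convol (reflect (\<lambda>\<xi>. cnj (G \<xi>))) G)"
proof -
  have "(1 / sqrt (sqrt (2 * pi)))\<^sup>2 = 1 / sqrt (2 * pi)" by (simp add: power_divide)
  hence "fourier (\<lambda>x. of_real ((norm (u x))\<^sup>2)) = convol (reflect (\<lambda>\<xi>. cnj (G \<xi>))) G"
    unfolding G_def
    by (intro ext) (simp only: fourier_norm_square[OF u] convol_reflect_cnj_scale)
  thus ?thesis by (simp only: sign_fun_def)
qed

lemma nonneg_Reals_mult_of_real_iff:
  assumes "c > 0"
  shows "\<sigma> * (of_real c * z) \<in> \<real>\<^sub>\<ge>\<^sub>0 \<longleftrightarrow> \<sigma> * z \<in> (\<real>\<^sub>\<ge>\<^sub>0 :: complex set)"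
proof -
  have "\<sigma> * (of_real c * z) = of_real c * (\<sigma> * z)" by (rule mult.left_commute)
  moreover have "of_real c * w \<in> \<real>\<^sub>\<ge>\<^sub>0 \<longleftrightarrow> w \<in> \<real>\<^sub>\<ge>\<^sub>0" for w :: complex
    using assms by (auto simp: complex_nonneg_Reals_iff zero_le_mult_iff)
  ultimately show ?thesis by (simp only:)
qed

theorem theorem4p2:
  fixes h b s :: "(real \<Rightarrow> complex) \<Rightarrow> complex" and \<sigma> :: complex
  assumes "h \<in> antidual Zplus_space Zplus_topology"
    and "real_functional h"
    and "b = b_fun h"
    and "s = sign_fun h"
    and "\<sigma> = 1 \<or> \<sigma> = - 1"
  shows "((\<forall>f\<in>D_space. \<sigma> * h (laplace_conv (\<lambda>t. cnj (f t)) f) \<in> \<real>\<^sub>\<ge>\<^sub>0)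
            \<longleftrightarrow> (\<forall>g\<in>test_funs. \<sigma> * b (convol (reflect (\<lambda>\<xi>. cnj (g \<xi>))) g) \<in> \<real>\<^sub>\<ge>\<^sub>0))
       \<and> ((\<forall>g\<in>test_funs. \<sigma> * b (convol (reflect (\<lambda>\<xi>. cnj (g \<xi>))) g) \<in> \<real>\<^sub>\<ge>\<^sub>0)
            \<longleftrightarrow> (\<forall>u\<in>Z_space. \<sigma> * s (\<lambda>x. of_real ((norm (u x))\<^sup>2)) \<in> \<real>\<^sub>\<ge>\<^sub>0))"
proof -
  define k where "k = sqrt (sqrt (2 * pi))"
  have k: "k \<noteq> 0" by (simp add: k_def)
  \<comment> \<open>\<open>F\<close> and \<open>U\<close> carry the arguments of the conditions into
    one another: \<open>F\<close> from test functions to D, \<open>U\<close> from Z to test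
    functions. The factors k and 1/k are those of \<open>b_fun_convol\<close> and
    \<open>sign_fun_norm_square\<close>, so corresponding values differ by a positive real factor
    only.\<close>
  define F where "F = (\<lambda>G. mellin_inv (\<lambda>\<xi>. of_real k * (inverse (Gamma (1/2 + \<i> * of_real \<xi>)) * G \<xi>)))"
  define U where "U = (\<lambda>u \<xi>. of_real (1 / k) * fourier u \<xi>)"
  have bF: "\<sigma> * b (convol (reflect (\<lambda>\<xi>. cnj (G \<xi>))) G) \<in> \<real>\<^sub>\<ge>\<^sub>0 \<longleftrightarrow>
              \<sigma> * h (laplace_conv (\<lambda>t. cnj (F G t)) (F G)) \<in> \<real>\<^sub>\<ge>\<^sub>0" if "G \<in> test_funs" for G
    unfolding \<open>b = b_fun h\<close> b_fun_convol[OF that] F_def k_def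
    by (rule nonneg_Reals_mult_of_real_iff) simp
  have sU: "\<sigma> * s (\<lambda>x. of_real ((norm (u x))\<^sup>2)) \<in> \<real>\<^sub>\<ge>\<^sub>0 \<longleftrightarrow>
              \<sigma> * b (convol (reflect (\<lambda>\<xi>. cnj (U u \<xi>))) (U u)) \<in> \<real>\<^sub>\<ge>\<^sub>0" if "u \<in> Z_space" for u
    unfolding \<open>b = b_fun h\<close> \<open>s = sign_fun h\<close> sign_fun_norm_square[OF that] U_def k_def
    by (rule nonneg_Reals_mult_of_real_iff) simp
  have F_mem: "F G \<in> D_space" if "G \<in> test_funs" for G
    unfolding F_def using that
    by (intro mellin_inv_D_space smooth_fun_mult_test_funs smooth_fun_const smooth_fun_inverse_Gamma_line)
  have F_surj: "\<exists>G\<in>test_funs. f = F G" if f: "f \<in> D_space" for f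
  proof -
    obtain g where g: "g \<in> test_funs" "f = mellin_inv g" using D_space_mellin_inv[OF f] by blast
    define G where "G = (\<lambda>\<xi>. of_real (1 / k) * (Gamma (1/2 + \<i> * of_real \<xi>) * g \<xi>))"
    have "G \<in> test_funs" unfolding G_def
      by (intro smooth_fun_mult_test_funs smooth_fun_const smooth_fun_Gamma_line g)
    moreover have "g = (\<lambda>\<xi>. of_real k * (inverse (Gamma (1/2 + \<i> * of_real \<xi>)) * G \<xi>))"
      using Gamma_Re_pos_neq_0[of "1/2 + \<i> * of_real _"] k by (simp add: G_def fun_eq_iff)
    hence "f = F G" unfolding F_def g(2) by (rule arg_cong)
    ultimately show ?thesis by blast
  qed
  have U_mem: "U u \<in> test_funs" if "u \<in> Z_space" for u
    unfolding U_def by (intro smooth_fun_mult_test_funs smooth_fun_const fourier_Z_space that)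
  have U_surj: "\<exists>u\<in>Z_space. G = U u" if G: "G \<in> test_funs" for G
  proof
    have kG: "(\<lambda>\<xi>. of_real k * G \<xi>) \<in> test_funs"
      by (intro smooth_fun_mult_test_funs smooth_fun_const G)
    thus "fourier_adj (\<lambda>\<xi>. of_real k * G \<xi>) \<in> Z_space" by (rule fourier_adj_test_funs)
    show "G = U (fourier_adj (\<lambda>\<xi>. of_real k * G \<xi>))"
      unfolding U_def fourier_adj_test_funs(2)[OF kG] using k by simp
  qed
  \<comment> \<open>Both maps land in their target and are onto, so a quantifier over the target
    pulls back to the source, where \<open>bF\<close> and \<open>sU\<close> match the conditions
    pointwise.\<close>
  have "(\<forall>f\<in>D_space. A f) \<longleftrightarrow> (\<forall>G\<in>test_funs. A (F G))" for A :: "(real \<Rightarrow> complex) \<Rightarrow> bool"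
    using F_mem F_surj by blast
  moreover have "(\<forall>G\<in>test_funs. A G) \<longleftrightarrow> (\<forall>u\<in>Z_space. A (U u))" for A :: "(real \<Rightarrow> complex) \<Rightarrow> bool"
    using U_mem U_surj by blast
  ultimately show ?thesis by (simp only: bF sU U_mem cong: ball_cong)
qed

end
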